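(* Let $(R,P_\Omega)$ be a multiple Rota-Baxter algebra of pair weight $(\lambda_\Omega,\lambda_\Omega)$ and let $X$ be a set. Let $(M_R(X)/I_X,\overline{\mathfrak{m}}'_\Omega)$ be the left $(R,P_\Omega)$-module constructed in the context, and let $j=\pi\circ j_X:X\to M_R(X)\to M_R(X)/I_X$, where $j_X(x)=\mathbf{1}_R\otimes x$ and $\pi$ is the quotient map. Then $(M_R(X)/I_X,\overline{\mathfrak{m}}'_\Omega)$ together with $j$ is the free left $(R,P_\Omega)$-module on $X$.
   Context: $\mathbf{k}$ is a commutative unital ring; algebras are associative unital $\mathbf{k}$-algebras, modules are unital, "linear" means $\mathbf{k}$-linear, $\otimes=\otimes_{\mathbf{k}}$. $\Omega$ is a nonempty set and $\lambda_\Omega=(\lambda_\omega)_{\omega\in\Omega}$ a family of elements of $\mathbf{k}$. A multiple Rota-Baxter algebra $(R,P_\Omega)$ of pair weight $(\lambda_\Omega,\lambda_\Omega)$ is an algebra $R$ with linear operators $P_\omega:R\to R$ ($\omega\in\Omega$) such that $P_\alpha(r)P_\beta(s)=P_\alpha(rP_\beta(s))+P_\beta(P_\alpha(r)s)+\lambda_\beta P_\alpha(rs)+\lambda_\alpha P_\beta(rs)$ for all $r,s\in R$, $\alpha,\beta\in\Omega$. A left $(R,P_\Omega)$-module $(M,\mathfrak{m}_\Omega)$ is a left $R$-module $M$ with linear operators $\mathfrak{m}_\omega:M\to M$ ($\omega\in\Omega$) such that $P_\alpha(r)\mathfrak{m}_\beta(m)=\mathfrak{m}_\alpha(r\mathfrak{m}_\beta(m))+\mathfrak{m}_\beta(P_\alpha(r)m)+\lambda_\beta\mathfrak{m}_\alpha(rm)+\lambda_\alpha\mathfrak{m}_\beta(rm)$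 for all $r\in R,m\in M,\alpha,\beta\in\Omega$. A homomorphism of left $(R,P_\Omega)$-modules is a left $R$-module homomorphism $\phi:(M,\mathfrak{m}_\Omega)\to(N,\mathfrak{n}_\Omega)$ with $\phi\circ\mathfrak{m}_\omega=\mathfrak{n}_\omega\circ\phi$ for all $\omega$. A free left $(R,P_\Omega)$-module on $X$ is a left $(R,P_\Omega)$-module $(F,\mathfrak{p}_\Omega)$ with a set map $j:X\to F$ such that for every left $(R,P_\Omega)$-module $(M,\mathfrak{m}_\Omega)$ and set map $\varphi:X\to M$ there is a unique left $(R,P_\Omega)$-module homomorphism $\widetilde\varphi:F\to M$ with $\widetilde\varphi\circ j=\varphi$. Construction: for a set $Y$, $\mathbf{k}Y$ is the free $\mathbf{k}$-module on $Y$. Put $M_1(X)=R\otimes\mathbf{k}X$, $M_n(X)=M_1(X)\oplus(R\otimes\mathbf{k}\Omega\otimes M_{n-1}(X))$ for $n\ge2$, and $M_R(X)=\bigcup_{n\ge1}M_n(X)$; equivalently $M_R(X)=\bigoplus_{n\ge1}(R\otimes\mathbf{k}\Omega)^{\otimes(n-1)}\otimes R\otimes\mathbf{k}X$. $R$ acts by left multiplication on the first tensor factor, and $\mathfrak{m}'_\omega(a)=\mathbf{1}_R\otimes\omega\otimes a$ for $a\in M_R(X)$, $\omega\in\Omega$. $I_X$ is the smallest $R$-submodule of $M_R(X)$ stable under all $\mathfrak{m}'_\omega$ and containing all elements $P_\alpha(r)\mathfrak{m}'_\beta(a)-\mathfrak{m}'_\alpha(r\mathfrak{m}'_\beta(a))-\mathfrak{m}'_\beta(P_\alpha(r)a)-\lambda_\beta\mathfrak{m}'_\alpha(ra)-\lambda_\alpha\mathfrak{m}'_\beta(ra)$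 with $r\in R,a\in M_R(X),\alpha,\beta\in\Omega$. The operators on the quotient are $\overline{\mathfrak{m}}'_\omega(a+I_X)=\mathfrak{m}'_\omega(a)+I_X$. *)

theory Defs
  imports "HOL-Algebra.QuotRing" "HOL-Algebra.Module"
begin

section \<open>Algebras, left modules, linear maps\<close>

text \<open>
  The library's \<^locale>\<open>algebra\<close> requires a commutative algebra and its \<^locale>\<open>module\<close> a
  commutative ground ring, so the noncommutative versions are introduced here. A left module
  is a record of the library's module type, whose fields \<open>mult\<close> and \<open>one\<close> play no role.
\<close>

locale unital_algebra = K?: cring K + A?: ring A + module K A
  for K :: "('k, 'p) ring_scheme" and A :: "('k, 'a, 'q) module_scheme" +
  assumes smult_mult_left:
      "\<lbrakk>c \<in> carrier K; x \<in> carrier A; y \<in> carrier A\<rbrakk> \<Longrightarrow>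
        (c \<odot>\<^bsub>A\<^esub> x) \<otimes>\<^bsub>A\<^esub> y = c \<odot>\<^bsub>A\<^esub> (x \<otimes>\<^bsub>A\<^esub> y)"
    and smult_mult_right:
      "\<lbrakk>c \<in> carrier K; x \<in> carrier A; y \<in> carrier A\<rbrakk> \<Longrightarrow>
        x \<otimes>\<^bsub>A\<^esub> (c \<odot>\<^bsub>A\<^esub> y) = c \<odot>\<^bsub>A\<^esub> (x \<otimes>\<^bsub>A\<^esub> y)"

locale left_module = A?: ring A + M?: abelian_group M
  for A :: "('a, 'p) ring_scheme" and M :: "('a, 'm, 'q) module_scheme" +
  assumes lsmult_closed:
      "\<lbrakk>a \<in> carrier A; x \<in> carrier M\<rbrakk> \<Longrightarrow> a \<odot>\<^bsub>M\<^esub> x \<in> carrier M"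
    and lsmult_l_distr:
      "\<lbrakk>a \<in> carrier A; b \<in> carrier A; x \<in> carrier M\<rbrakk> \<Longrightarrow>
        (a \<oplus>\<^bsub>A\<^esub> b) \<odot>\<^bsub>M\<^esub> x = a \<odot>\<^bsub>M\<^esub> x \<oplus>\<^bsub>M\<^esub> b \<odot>\<^bsub>M\<^esub> x"
    and lsmult_r_distr:
      "\<lbrakk>a \<in> carrier A; x \<in> carrier M; y \<in> carrier M\<rbrakk> \<Longrightarrow>
        a \<odot>\<^bsub>M\<^esub> (x \<oplus>\<^bsub>M\<^esub> y) = a \<odot>\<^bsub>M\<^esub> x \<oplus>\<^bsub>M\<^esub> a \<odot>\<^bsub>M\<^esub> y"
    and lsmult_assoc:
      "\<lbrakk>a \<in> carrier A; b \<in> carrier A; x \<in> carrier M\<rbrakk> \<Longrightarrow>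
        (a \<otimes>\<^bsub>A\<^esub> b) \<odot>\<^bsub>M\<^esub> x = a \<odot>\<^bsub>M\<^esub> (b \<odot>\<^bsub>M\<^esub> x)"
    and lsmult_one:
      "x \<in> carrier M \<Longrightarrow> \<one>\<^bsub>A\<^esub> \<odot>\<^bsub>M\<^esub> x = x"

definition linear_maps ::
  "('a, 'p) ring_scheme \<Rightarrow> ('a, 'm, 'q) module_scheme \<Rightarrow> ('a, 'n, 's) module_scheme \<Rightarrow> ('m \<Rightarrow> 'n) set"
  where "linear_maps A M N =
    {h \<in> carrier M \<rightarrow> carrier N.
      (\<forall>x\<in>carrier M. \<forall>y\<in>carrier M. h (x \<oplus>\<^bsub>M\<^esub> y) = h x \<oplus>\<^bsub>N\<^esub> h y) \<and>
      (\<forall>a\<in>carrier A. \<forall>x\<in>carrier M. h (a \<odot>\<^bsub>M\<^esub> x) = a \<odot>\<^bsub>N\<^esub> h x)}"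

text \<open>A left module over a \<open>K\<close>-algebra \<open>A\<close> is a \<open>K\<close>-module through \<open>c \<mapsto> c 1\<^sub>A\<close>.\<close>

definition restrict_scalars ::
  "('k, 'a, 'p) module_scheme \<Rightarrow> ('a, 'm, 'q) module_scheme \<Rightarrow> ('k, 'm) module"
  where "restrict_scalars A M =
    \<lparr>carrier = carrier M, mult = mult M, one = one M, zero = zero M, add = add M,
      smult = (\<lambda>c x. (c \<odot>\<^bsub>A\<^esub> \<one>\<^bsub>A\<^esub>) \<odot>\<^bsub>M\<^esub> x)\<rparr>"


section \<open>Multiple Rota-Baxter algebras and their modules\<close>

locale multiple_RB_algebra = unital_algebra K R
  for K :: "('k, 'p) ring_scheme" and R :: "('k, 'r, 'q) module_scheme" +
  fixes \<Omega> :: "'w set" and lam :: "'w \<Rightarrow> 'k" and P :: "'w \<Rightarrow> 'r \<Rightarrow> 'r"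
  assumes weight_closed: "\<omega> \<in> \<Omega> \<Longrightarrow> lam \<omega> \<in> carrier K"
    and P_linear: "\<omega> \<in> \<Omega> \<Longrightarrow> P \<omega> \<in> linear_maps K R R"
    and RB_identity:
      "\<lbrakk>\<alpha> \<in> \<Omega>; \<beta> \<in> \<Omega>; r \<in> carrier R; s \<in> carrier R\<rbrakk> \<Longrightarrow>
        P \<alpha> r \<otimes>\<^bsub>R\<^esub> P \<beta> s =
          P \<alpha> (r \<otimes>\<^bsub>R\<^esub> P \<beta> s) \<oplus>\<^bsub>R\<^esub> P \<beta> (P \<alpha> r \<otimes>\<^bsub>R\<^esub> s)
          \<oplus>\<^bsub>R\<^esub> lam \<beta> \<odot>\<^bsub>R\<^esub> P \<alpha> (r \<otimes>\<^bsub>R\<^esub> s) \<oplus>\<^bsub>R\<^esub> lam \<alpha> \<odot>\<^bsub>R\<^esub> P \<beta> (r \<otimes>\<^bsub>R\<^esub> s)"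

locale RB_module = multiple_RB_algebra K R \<Omega> lam P + left_module R M
  for K :: "('k, 'p) ring_scheme" and R :: "('k, 'r, 'q) module_scheme"
    and \<Omega> :: "'w set" and lam P and M :: "('r, 'm, 's) module_scheme" +
  fixes m :: "'w \<Rightarrow> 'm \<Rightarrow> 'm"
  assumes m_linear:
      "\<omega> \<in> \<Omega> \<Longrightarrow> m \<omega> \<in> linear_maps K (restrict_scalars R M) (restrict_scalars R M)"
    and RB_module_identity:
      "\<lbrakk>\<alpha> \<in> \<Omega>; \<beta> \<in> \<Omega>; r \<in> carrier R; x \<in> carrier M\<rbrakk> \<Longrightarrow>
        P \<alpha> r \<odot>\<^bsub>M\<^esub> m \<beta> x =
          m \<alpha> (r \<odot>\<^bsub>M\<^esub> m \<beta> x) \<oplus>\<^bsub>M\<^esub> m \<beta> (P \<alpha> r \<odot>\<^bsub>M\<^esub> x)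
          \<oplus>\<^bsub>M\<^esub> lam \<beta> \<odot>\<^bsub>restrict_scalars R M\<^esub> m \<alpha> (r \<odot>\<^bsub>M\<^esub> x)
          \<oplus>\<^bsub>M\<^esub> lam \<alpha> \<odot>\<^bsub>restrict_scalars R M\<^esub> m \<beta> (r \<odot>\<^bsub>M\<^esub> x)"

definition RB_module_homs ::
  "('r, 'p) ring_scheme \<Rightarrow> 'w set \<Rightarrow> ('r, 'm, 'q) module_scheme \<Rightarrow> ('w \<Rightarrow> 'm \<Rightarrow> 'm) \<Rightarrow>
    ('r, 'n, 's) module_scheme \<Rightarrow> ('w \<Rightarrow> 'n \<Rightarrow> 'n) \<Rightarrow> ('m \<Rightarrow> 'n) set"
  where "RB_module_homs R \<Omega> M m N n =
    {h \<in> linear_maps R M N. \<forall>\<omega>\<in>\<Omega>. \<forall>x\<in>carrier M. h (m \<omega> x) = n \<omega> (h x)}"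

text \<open>
  The universal property is tested against modules whose elements live in the type \<open>'m\<close>,
  which the type argument makes explicit; a statement with \<open>'m\<close> a free type variable covers
  modules over every type. Homomorphisms are functions on the carrier, i.e. extensional, so
  that uniqueness is meaningful.
\<close>

definition is_free_RB_module ::
  "'m itself \<Rightarrow> ('k, 'p) ring_scheme \<Rightarrow> ('k, 'r, 'q) module_scheme \<Rightarrow> 'w set \<Rightarrow> ('w \<Rightarrow> 'k) \<Rightarrow>
    ('w \<Rightarrow> 'r \<Rightarrow> 'r) \<Rightarrow> 'x set \<Rightarrow> ('r, 'f) module \<Rightarrow> ('w \<Rightarrow> 'f \<Rightarrow> 'f) \<Rightarrow> ('x \<Rightarrow> 'f) \<Rightarrow> bool"
  where "is_free_RB_module (_ :: 'm itself) K R \<Omega> lam P X F p j \<longleftrightarrow>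
    RB_module K R \<Omega> lam P F p \<and> j \<in> X \<rightarrow> carrier F \<and>
    (\<forall>(M :: ('r, 'm) module) m \<phi>.
      RB_module K R \<Omega> lam P M m \<and> \<phi> \<in> X \<rightarrow> carrier M \<longrightarrow>
      (\<exists>!h. h \<in> RB_module_homs R \<Omega> F p M m \<inter> extensional (carrier F) \<and>
            (\<forall>x\<in>X. h (j x) = \<phi> x)))"


section \<open>Direct sums, free modules, quotients\<close>

definition direct_sum :: "'i set \<Rightarrow> ('i \<Rightarrow> ('a, 'm) module) \<Rightarrow> ('a, 'i \<Rightarrow> 'm) module"
  where "direct_sum I V =
    \<lparr>carrier = {f \<in> (\<Pi>\<^sub>E i\<in>I. carrier (V i)). finite {i \<in> I. f i \<noteq> \<zero>\<^bsub>V i\<^esub>}},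
      mult = undefined, one = undefined,
      zero = (\<lambda>i\<in>I. \<zero>\<^bsub>V i\<^esub>),
      add = (\<lambda>f g. \<lambda>i\<in>I. f i \<oplus>\<^bsub>V i\<^esub> g i),
      smult = (\<lambda>a f. \<lambda>i\<in>I. a \<odot>\<^bsub>V i\<^esub> f i)\<rparr>"

definition regular_module :: "('k, 'p) ring_scheme \<Rightarrow> ('k, 'k) module"
  where "regular_module K =
    \<lparr>carrier = carrier K, mult = mult K, one = one K, zero = zero K, add = add K,
      smult = mult K\<rparr>"

definition free_module :: "('k, 'p) ring_scheme \<Rightarrow> 'y set \<Rightarrow> ('k, 'y \<Rightarrow> 'k) module"
  where "free_module K Y = direct_sum Y (\<lambda>_. regular_module K)"

definition basis_elem :: "('k, 'p) ring_scheme \<Rightarrow> 'y set \<Rightarrow> 'y \<Rightarrow> ('y \<Rightarrow> 'k)"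
  where "basis_elem K Y y = (\<lambda>z\<in>Y. if z = y then \<one>\<^bsub>K\<^esub> else \<zero>\<^bsub>K\<^esub>)"

definition linear_extension ::
  "('k, 'p) ring_scheme \<Rightarrow> 'y set \<Rightarrow> ('k, 'm) module \<Rightarrow> ('y \<Rightarrow> 'm) \<Rightarrow> ('y \<Rightarrow> 'k) \<Rightarrow> 'm"
  where "linear_extension K Y V f g =
    (\<Oplus>\<^bsub>V\<^esub>y\<in>{y \<in> Y. g y \<noteq> \<zero>\<^bsub>K\<^esub>}. g y \<odot>\<^bsub>V\<^esub> f y)"

definition submodule_span :: "('a, 'p) ring_scheme \<Rightarrow> ('a, 'm) module \<Rightarrow> 'm set \<Rightarrow> 'm set"
  where "submodule_span A M S = \<Inter>{N. submodule N A M \<and> S \<subseteq> N}"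

text \<open>
  The map on cosets \<open>N' + c \<mapsto> N + f c\<close> (\<open>N\<close> being a subgroup of \<open>M\<close>), written without a
  choice of representative as in the library's \<^const>\<open>rcoset_mult\<close>.
\<close>

definition coset_map :: "('a, 'm) module \<Rightarrow> 'm set \<Rightarrow> ('n \<Rightarrow> 'm) \<Rightarrow> 'n set \<Rightarrow> 'm set"
  where "coset_map M N f C = (\<Union>c\<in>C. N +>\<^bsub>M\<^esub> f c)"

definition quotient_module :: "('a, 'm) module \<Rightarrow> 'm set \<Rightarrow> ('a, 'm set) module"
  where "quotient_module M N =
    \<lparr>carrier = a_rcosets\<^bsub>M\<^esub> N, mult = undefined, one = undefined,
      zero = N, add = set_add M, smult = (\<lambda>a. coset_map M N (\<lambda>x. a \<odot>\<^bsub>M\<^esub> x))\<rparr>"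


section \<open>The tensor modules $(R \otimes K\Omega)^{\otimes (n-1)} \otimes R \otimes KX$\<close>

text \<open>
  The iterated tensor product over \<open>K\<close> is formed in one step: it is the free \<open>K\<close>-module on the
  tuples \<open>(r\<^sub>1, u\<^sub>1, \<dots>, r\<^sub>n\<^sub>-\<^sub>1, u\<^sub>n\<^sub>-\<^sub>1, r\<^sub>n, v)\<close> with \<open>r\<^sub>i \<in> R\<close>, \<open>u\<^sub>i \<in> K\<Omega>\<close>, \<open>v \<in> KX\<close>, modulo linearity in
  each of the \<open>2n\<close> entries. A tuple is encoded as \<open>([(r\<^sub>1, u\<^sub>1), \<dots>, (r\<^sub>n\<^sub>-\<^sub>1, u\<^sub>n\<^sub>-\<^sub>1)], r\<^sub>n, v)\<close>.
\<close>

type_synonym ('k, 'r, 'w, 'x) tuple = "('r \<times> ('w \<Rightarrow> 'k)) list \<times> 'r \<times> ('x \<Rightarrow> 'k)"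

definition tensor_tuples ::
  "('k, 'p) ring_scheme \<Rightarrow> ('k, 'r, 'q) module_scheme \<Rightarrow> 'w set \<Rightarrow> 'x set \<Rightarrow> nat \<Rightarrow>
    ('k, 'r, 'w, 'x) tuple set"
  where "tensor_tuples K R \<Omega> X n =
    {(ps, r, v). length ps + 1 = n \<and> set ps \<subseteq> carrier R \<times> carrier (free_module K \<Omega>) \<and>
      r \<in> carrier R \<and> v \<in> carrier (free_module K X)}"

text \<open>
  Linearity in one entry: \<open>V\<close> is the module this entry ranges over, and \<open>c\<close> places an element of
  \<open>V\<close> in that entry, the other entries being fixed.
\<close>

definition slot_relations ::
  "('k, 'p) ring_scheme \<Rightarrow> 't set \<Rightarrow> ('k, 'v, 'q) module_scheme \<Rightarrow> ('v \<Rightarrow> 't) \<Rightarrow> ('t \<Rightarrow> 'k) set"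
  where "slot_relations K T V c =
    {basis_elem K T (c (u \<oplus>\<^bsub>V\<^esub> v)) \<ominus>\<^bsub>free_module K T\<^esub>
        (basis_elem K T (c u) \<oplus>\<^bsub>free_module K T\<^esub> basis_elem K T (c v)) | u v.
      u \<in> carrier V \<and> v \<in> carrier V} \<union>
    {basis_elem K T (c (a \<odot>\<^bsub>V\<^esub> u)) \<ominus>\<^bsub>free_module K T\<^esub>
        a \<odot>\<^bsub>free_module K T\<^esub> basis_elem K T (c u) | a u.
      a \<in> carrier K \<and> u \<in> carrier V}"

definition tensor_relations ::
  "('k, 'p) ring_scheme \<Rightarrow> ('k, 'r, 'q) module_scheme \<Rightarrow> 'w set \<Rightarrow> 'x set \<Rightarrow> nat \<Rightarrow>
    (('k, 'r, 'w, 'x) tuple \<Rightarrow> 'k) set"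
  where "tensor_relations K R \<Omega> X n =
    (let T = tensor_tuples K R \<Omega> X n;
         A = carrier R \<times> carrier (free_module K \<Omega>)
     in
      (\<Union>{slot_relations K T R (\<lambda>t. (ps @ (t, u) # qs, r, v)) | ps u qs r v.
          length ps + length qs + 2 = n \<and> set ps \<subseteq> A \<and> set qs \<subseteq> A \<and>
          u \<in> carrier (free_module K \<Omega>) \<and> r \<in> carrier R \<and> v \<in> carrier (free_module K X)}) \<union>
      (\<Union>{slot_relations K T (free_module K \<Omega>) (\<lambda>t. (ps @ (s, t) # qs, r, v)) | ps s qs r v.
          length ps + length qs + 2 = n \<and> set ps \<subseteq> A \<and> set qs \<subseteq> A \<and>
          s \<in> carrier R \<and> r \<in> carrier R \<and> v \<in> carrier (free_module K X)}) \<union>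
      (\<Union>{slot_relations K T R (\<lambda>t. (ps, t, v)) | ps v.
          length ps + 1 = n \<and> set ps \<subseteq> A \<and> v \<in> carrier (free_module K X)}) \<union>
      (\<Union>{slot_relations K T (free_module K X) (\<lambda>t. (ps, r, t)) | ps r.
          length ps + 1 = n \<and> set ps \<subseteq> A \<and> r \<in> carrier R}))"

definition tensor_kernel ::
  "('k, 'p) ring_scheme \<Rightarrow> ('k, 'r, 'q) module_scheme \<Rightarrow> 'w set \<Rightarrow> 'x set \<Rightarrow> nat \<Rightarrow>
    (('k, 'r, 'w, 'x) tuple \<Rightarrow> 'k) set"
  where "tensor_kernel K R \<Omega> X n =
    submodule_span K (free_module K (tensor_tuples K R \<Omega> X n)) (tensor_relations K R \<Omega> X n)"

definition tensor_module ::
  "('k, 'p) ring_scheme \<Rightarrow> ('k, 'r, 'q) module_scheme \<Rightarrow> 'w set \<Rightarrow> 'x set \<Rightarrow> nat \<Rightarrow>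
    ('k, (('k, 'r, 'w, 'x) tuple \<Rightarrow> 'k) set) module"
  where "tensor_module K R \<Omega> X n =
    quotient_module (free_module K (tensor_tuples K R \<Omega> X n)) (tensor_kernel K R \<Omega> X n)"

definition pure_tensor ::
  "('k, 'p) ring_scheme \<Rightarrow> ('k, 'r, 'q) module_scheme \<Rightarrow> 'w set \<Rightarrow> 'x set \<Rightarrow> nat \<Rightarrow>
    ('k, 'r, 'w, 'x) tuple \<Rightarrow> (('k, 'r, 'w, 'x) tuple \<Rightarrow> 'k) set"
  where "pure_tensor K R \<Omega> X n t =
    tensor_kernel K R \<Omega> X n +>\<^bsub>free_module K (tensor_tuples K R \<Omega> X n)\<^esub>
      basis_elem K (tensor_tuples K R \<Omega> X n) t"

text \<open>
  The \<open>K\<close>-linear map from the \<open>n\<close>-th to the \<open>n'\<close>-th tensor module that sends the pure tensor of a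
  tuple \<open>t\<close> to the pure tensor of \<open>f t\<close>.
\<close>

definition tensor_map ::
  "('k, 'p) ring_scheme \<Rightarrow> ('k, 'r, 'q) module_scheme \<Rightarrow> 'w set \<Rightarrow> 'x set \<Rightarrow> nat \<Rightarrow> nat \<Rightarrow>
    (('k, 'r, 'w, 'x) tuple \<Rightarrow> ('k, 'r, 'w, 'x) tuple) \<Rightarrow>
    (('k, 'r, 'w, 'x) tuple \<Rightarrow> 'k) set \<Rightarrow> (('k, 'r, 'w, 'x) tuple \<Rightarrow> 'k) set"
  where "tensor_map K R \<Omega> X n n' f =
    (let T = tensor_tuples K R \<Omega> X n; T' = tensor_tuples K R \<Omega> X n'; F' = free_module K T'
     in coset_map F' (tensor_kernel K R \<Omega> X n')
          (linear_extension K T F' (\<lambda>t. basis_elem K T' (f t))))"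

fun left_mult_tuple ::
  "('k, 'r, 'q) module_scheme \<Rightarrow> 'r \<Rightarrow> ('k, 'r, 'w, 'x) tuple \<Rightarrow> ('k, 'r, 'w, 'x) tuple"
  where
    "left_mult_tuple R r ([], s, v) = ([], r \<otimes>\<^bsub>R\<^esub> s, v)"
  | "left_mult_tuple R r ((t, u) # ps, s, v) = ((r \<otimes>\<^bsub>R\<^esub> t, u) # ps, s, v)"

definition tensor_left_module ::
  "('k, 'p) ring_scheme \<Rightarrow> ('k, 'r, 'q) module_scheme \<Rightarrow> 'w set \<Rightarrow> 'x set \<Rightarrow> nat \<Rightarrow>
    ('r, (('k, 'r, 'w, 'x) tuple \<Rightarrow> 'k) set) module"
  where "tensor_left_module K R \<Omega> X n =
    (let T = tensor_module K R \<Omega> X n in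
      \<lparr>carrier = carrier T, mult = mult T, one = one T, zero = zero T, add = add T,
        smult = (\<lambda>r. tensor_map K R \<Omega> X n n (left_mult_tuple R r))\<rparr>)"


section \<open>The module $M_R(X)$, its operators, and the quotient by $I_X$\<close>

type_synonym ('k, 'r, 'w, 'x) MR = "nat \<Rightarrow> (('k, 'r, 'w, 'x) tuple \<Rightarrow> 'k) set"

definition MR_module ::
  "('k, 'p) ring_scheme \<Rightarrow> ('k, 'r, 'q) module_scheme \<Rightarrow> 'w set \<Rightarrow> 'x set \<Rightarrow>
    ('r, ('k, 'r, 'w, 'x) MR) module"
  where "MR_module K R \<Omega> X = direct_sum {1..} (tensor_left_module K R \<Omega> X)"

text \<open>\<open>a \<mapsto> 1\<^sub>R \<otimes> \<omega> \<otimes> a\<close>, raising the degree by one.\<close>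

definition MR_op ::
  "('k, 'p) ring_scheme \<Rightarrow> ('k, 'r, 'q) module_scheme \<Rightarrow> 'w set \<Rightarrow> 'x set \<Rightarrow> 'w \<Rightarrow>
    ('k, 'r, 'w, 'x) MR \<Rightarrow> ('k, 'r, 'w, 'x) MR"
  where "MR_op K R \<Omega> X \<omega> a =
    (\<lambda>n\<in>{1..}. if n = 1 then \<zero>\<^bsub>tensor_module K R \<Omega> X 1\<^esub>
      else tensor_map K R \<Omega> X (n - 1) n
             (\<lambda>(ps, s, v). ((\<one>\<^bsub>R\<^esub>, basis_elem K \<Omega> \<omega>) # ps, s, v)) (a (n - 1)))"

definition MR_incl ::
  "('k, 'p) ring_scheme \<Rightarrow> ('k, 'r, 'q) module_scheme \<Rightarrow> 'w set \<Rightarrow> 'x set \<Rightarrow> 'x \<Rightarrow>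
    ('k, 'r, 'w, 'x) MR"
  where "MR_incl K R \<Omega> X x =
    (\<lambda>n\<in>{1..}. if n = 1 then pure_tensor K R \<Omega> X 1 ([], \<one>\<^bsub>R\<^esub>, basis_elem K X x)
      else \<zero>\<^bsub>tensor_module K R \<Omega> X n\<^esub>)"

definition RB_relations ::
  "('k, 'p) ring_scheme \<Rightarrow> ('k, 'r, 'q) module_scheme \<Rightarrow> 'w set \<Rightarrow> ('w \<Rightarrow> 'k) \<Rightarrow>
    ('w \<Rightarrow> 'r \<Rightarrow> 'r) \<Rightarrow> 'x set \<Rightarrow> ('k, 'r, 'w, 'x) MR set"
  where "RB_relations K R \<Omega> lam P X =
    (let M = MR_module K R \<Omega> X; m = MR_op K R \<Omega> X in
      {P \<alpha> r \<odot>\<^bsub>M\<^esub> m \<beta> a \<ominus>\<^bsub>M\<^esub> m \<alpha> (r \<odot>\<^bsub>M\<^esub> m \<beta> a) \<ominus>\<^bsub>M\<^esub> m \<beta> (P \<alpha> r \<odot>\<^bsub>M\<^esub> a)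
        \<ominus>\<^bsub>M\<^esub> lam \<beta> \<odot>\<^bsub>restrict_scalars R M\<^esub> m \<alpha> (r \<odot>\<^bsub>M\<^esub> a)
        \<ominus>\<^bsub>M\<^esub> lam \<alpha> \<odot>\<^bsub>restrict_scalars R M\<^esub> m \<beta> (r \<odot>\<^bsub>M\<^esub> a) | \<alpha> \<beta> r a.
        \<alpha> \<in> \<Omega> \<and> \<beta> \<in> \<Omega> \<and> r \<in> carrier R \<and> a \<in> carrier M})"

definition RB_ideal ::
  "('k, 'p) ring_scheme \<Rightarrow> ('k, 'r, 'q) module_scheme \<Rightarrow> 'w set \<Rightarrow> ('w \<Rightarrow> 'k) \<Rightarrow>
    ('w \<Rightarrow> 'r \<Rightarrow> 'r) \<Rightarrow> 'x set \<Rightarrow> ('k, 'r, 'w, 'x) MR set"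
  where "RB_ideal K R \<Omega> lam P X =
    \<Inter>{N. submodule N R (MR_module K R \<Omega> X) \<and>
          (\<forall>\<omega>\<in>\<Omega>. MR_op K R \<Omega> X \<omega> ` N \<subseteq> N) \<and> RB_relations K R \<Omega> lam P X \<subseteq> N}"

definition free_RB_module ::
  "('k, 'p) ring_scheme \<Rightarrow> ('k, 'r, 'q) module_scheme \<Rightarrow> 'w set \<Rightarrow> ('w \<Rightarrow> 'k) \<Rightarrow>
    ('w \<Rightarrow> 'r \<Rightarrow> 'r) \<Rightarrow> 'x set \<Rightarrow> ('r, ('k, 'r, 'w, 'x) MR set) module"
  where "free_RB_module K R \<Omega> lam P X =
    quotient_module (MR_module K R \<Omega> X) (RB_ideal K R \<Omega> lam P X)"

definition free_RB_op ::
  "('k, 'p) ring_scheme \<Rightarrow> ('k, 'r, 'q) module_scheme \<Rightarrow> 'w set \<Rightarrow> ('w \<Rightarrow> 'k) \<Rightarrow>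
    ('w \<Rightarrow> 'r \<Rightarrow> 'r) \<Rightarrow> 'x set \<Rightarrow> 'w \<Rightarrow> ('k, 'r, 'w, 'x) MR set \<Rightarrow> ('k, 'r, 'w, 'x) MR set"
  where "free_RB_op K R \<Omega> lam P X \<omega> =
    coset_map (MR_module K R \<Omega> X) (RB_ideal K R \<Omega> lam P X) (MR_op K R \<Omega> X \<omega>)"

definition free_RB_incl ::
  "('k, 'p) ring_scheme \<Rightarrow> ('k, 'r, 'q) module_scheme \<Rightarrow> 'w set \<Rightarrow> ('w \<Rightarrow> 'k) \<Rightarrow>
    ('w \<Rightarrow> 'r \<Rightarrow> 'r) \<Rightarrow> 'x set \<Rightarrow> 'x \<Rightarrow> ('k, 'r, 'w, 'x) MR set"
  where "free_RB_incl K R \<Omega> lam P X x =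
    RB_ideal K R \<Omega> lam P X +>\<^bsub>MR_module K R \<Omega> X\<^esub> MR_incl K R \<Omega> X x"

end

theory Submission
  imports Defs
begin

text \<open>
  The quotient \<open>M\<^sub>R(X) / I\<^sub>X\<close> is free because the construction adjoins exactly the operations of a
  left module with operators and then imposes exactly the Rota-Baxter identity.

  Existence. Let \<open>(M, m)\<close> be a module over the Rota-Baxter algebra and \<open>\<phi> : X \<rightarrow> M\<close>. A homomorphism
  extending \<open>\<phi>\<close> must send the tensor \<open>r\<^sub>1 \<otimes> \<omega>\<^sub>1 \<otimes> \<dots> \<otimes> r\<^sub>n \<otimes> x\<close> to
  \<open>r\<^sub>1 m\<^bsub>\<omega>\<^sub>1\<^esub>(r\<^sub>2 m\<^bsub>\<omega>\<^sub>2\<^esub>(\<dots> r\<^sub>n \<phi>(x)))\<close>. Extended linearly to all elements of \<open>K\<Omega>\<close> and \<open>KX\<close>, this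
  expression is linear in each entry (\<open>ev_multilinear\<close>), so it descends to the tensor modules
  (\<open>tensors_universal\<close>) and sums over the degrees to a map \<open>E\<close> on \<open>M\<^sub>R(X)\<close>. It is \<open>R\<close>-linear and
  commutes with the operators, since both hold on pure tensors (\<open>evaluation_exists\<close>). The kernel of
  \<open>E\<close> is then an \<open>R\<close>-submodule stable under the operators, and it contains the Rota-Baxter relations
  because \<open>M\<close> satisfies the Rota-Baxter identity; so it contains \<open>I\<^sub>X\<close>, and \<open>E\<close> factors through
  the quotient (\<open>hom_exists\<close>).

  Uniqueness. A submodule of \<open>M\<^sub>R(X)\<close> that is stable under the operators and contains every
  \<open>1 \<otimes> x\<close> is all of \<open>M\<^sub>R(X)\<close> (\<open>MR_generated\<close>). The elements at which two homomorphisms agree form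
  such a submodule (\<open>hom_unique\<close>).

  That the quotient is a module over the Rota-Baxter algebra at all (\<open>F_RB_module\<close>) holds because its
  defining relations are the instances of the module identity.

  The tensor modules are quotients of free modules on tuples, and the maps on them are given on coset
  representatives. The lemmas \<open>pure_multilinear\<close>, \<open>tensors_universal\<close>, \<open>tensors_generated\<close> and
  \<open>tensor_map_linear\<close> replace this description by the values of linear maps on pure tensors, which
  is the form in which the argument above uses them.
\<close>


section \<open>Left modules and linear maps\<close>

text \<open>
  The additive monoids of a ring record and of a module record have different types, so structures
  with equal carriers and additions have to be compared through the axioms.
\<close>

lemma comm_group_imp_abelian_group:
  assumes "comm_group G" "carrier M = carrier G" "add M = mult G" "zero M = one G"
  shows "abelian_group M"
proof -
  interpret comm_group G by fact
  show ?thesis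
    by (rule abelian_groupI) (auto simp: assms(2-4) m_assoc m_lcomm m_comm intro: l_inv_ex)
qed

lemma abelian_group_cong:
  assumes "abelian_group M" "carrier N = carrier M" "add N = add M" "zero N = zero M"
  shows "abelian_group N"
  using abelian_group.a_comm_group[OF assms(1)] assms(2-4)
  by (intro comm_group_imp_abelian_group[of "add_monoid M"]) auto

lemma (in abelian_group) minus_eq_zero_iff:
  "\<lbrakk>x \<in> carrier G; y \<in> carrier G\<rbrakk> \<Longrightarrow> x \<ominus> y = \<zero> \<longleftrightarrow> x = y"
  by (metis a_minus_def add.inv_closed add.inv_equality minus_minus r_neg)

lemma (in abelian_group) minus_eq_zero_iff4:
  assumes "x \<in> carrier G" "a \<in> carrier G" "b \<in> carrier G" "c \<in> carrier G" "d \<in> carrier G"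
  shows "x \<ominus> a \<ominus> b \<ominus> c \<ominus> d = \<zero> \<longleftrightarrow> x = a \<oplus> b \<oplus> c \<oplus> d"
proof -
  have "x \<ominus> a \<ominus> b \<ominus> c \<ominus> d = x \<ominus> (a \<oplus> b \<oplus> c \<oplus> d)"
    using assms by (simp add: a_minus_def minus_add a_ac)
  then show ?thesis using assms by (simp add: minus_eq_zero_iff)
qed

lemma module_imp_left_module: "module K M \<Longrightarrow> left_module K M"
  unfolding left_module_def left_module_axioms_def module_def module_axioms_def cring_def by simp

lemma linear_mapsI:
  assumes "\<And>x. x \<in> carrier M \<Longrightarrow> h x \<in> carrier N"
    and "\<And>x y. \<lbrakk>x \<in> carrier M; y \<in> carrier M\<rbrakk> \<Longrightarrow> h (x \<oplus>\<^bsub>M\<^esub> y) = h x \<oplus>\<^bsub>N\<^esub> h y"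
    and "\<And>a x. \<lbrakk>a \<in> carrier A; x \<in> carrier M\<rbrakk> \<Longrightarrow> h (a \<odot>\<^bsub>M\<^esub> x) = a \<odot>\<^bsub>N\<^esub> h x"
  shows "h \<in> linear_maps A M N"
  using assms unfolding linear_maps_def by auto

lemma linear_maps_closed: "\<lbrakk>h \<in> linear_maps A M N; x \<in> carrier M\<rbrakk> \<Longrightarrow> h x \<in> carrier N"
  and linear_maps_add: "\<lbrakk>h \<in> linear_maps A M N; x \<in> carrier M; y \<in> carrier M\<rbrakk>
    \<Longrightarrow> h (x \<oplus>\<^bsub>M\<^esub> y) = h x \<oplus>\<^bsub>N\<^esub> h y"
  and linear_maps_smult: "\<lbrakk>h \<in> linear_maps A M N; a \<in> carrier A; x \<in> carrier M\<rbrakk>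
    \<Longrightarrow> h (a \<odot>\<^bsub>M\<^esub> x) = a \<odot>\<^bsub>N\<^esub> h x"
  unfolding linear_maps_def by auto

lemma linear_maps_comp:
  assumes "f \<in> linear_maps A M N" "g \<in> linear_maps A N W"
  shows "(\<lambda>x. g (f x)) \<in> linear_maps A M W"
  by (rule linear_mapsI)
    (simp_all add: linear_maps_closed[OF assms(1)] linear_maps_closed[OF assms(2)]
      linear_maps_add[OF assms(1)] linear_maps_add[OF assms(2)]
      linear_maps_smult[OF assms(1)] linear_maps_smult[OF assms(2)])

lemma abelian_group_hom_intro:
  assumes "abelian_group M" "abelian_group N"
    and "\<And>x. x \<in> carrier M \<Longrightarrow> h x \<in> carrier N"
    and "\<And>x y. \<lbrakk>x \<in> carrier M; y \<in> carrier M\<rbrakk> \<Longrightarrow> h (x \<oplus>\<^bsub>M\<^esub> y) = h x \<oplus>\<^bsub>N\<^esub> h y"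
  shows "abelian_group_hom M N h"
proof (rule abelian_group_homI[OF assms(1,2)])
  interpret M: abelian_group M by fact
  interpret N: abelian_group N by fact
  show "group_hom (add_monoid M) (add_monoid N) h"
    using assms M.a_group N.a_group
    by (auto simp: group_hom_def group_hom_axioms_def hom_def)
qed

lemma linear_maps_hom:
  assumes "left_module A M" "left_module A N" "h \<in> linear_maps A M N"
  shows "abelian_group_hom M N h"
  using assms by (auto intro!: abelian_group_hom_intro simp: left_module_def
      linear_maps_closed linear_maps_add)

lemma linear_maps_zero:
  assumes "left_module A M" "left_module A N" "h \<in> linear_maps A M N"
  shows "h \<zero>\<^bsub>M\<^esub> = \<zero>\<^bsub>N\<^esub>"
  using linear_maps_hom[OF assms] by (rule abelian_group_hom.hom_zero)

lemma (in abelian_group_hom) hom_finsum: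
  assumes "f \<in> J \<rightarrow> carrier G"
  shows "h (finsum G f J) = finsum H (\<lambda>i. h (f i)) J"
  using assms
proof (induction J rule: infinite_finite_induct)
  case (insert i J)
  then have "f i \<in> carrier G" "f \<in> J \<rightarrow> carrier G" by auto
  moreover from this have "(\<lambda>i. h (f i)) \<in> J \<rightarrow> carrier H" "finsum G f J \<in> carrier G"
    by (auto simp: Pi_iff)
  ultimately show ?case using insert by (simp add: G.finsum_insert H.finsum_insert)
qed auto

lemma (in left_module) lsmult_hom:
  assumes "a \<in> carrier A"
  shows "abelian_group_hom M M (\<lambda>x. a \<odot>\<^bsub>M\<^esub> x)"
  using assms by (intro abelian_group_hom_intro)
    (auto simp: lsmult_closed lsmult_r_distr M.abelian_group_axioms)

lemma (in left_module) lsmult_orbit_hom: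
  assumes "x \<in> carrier M"
  shows "abelian_group_hom A M (\<lambda>a. a \<odot>\<^bsub>M\<^esub> x)"
  using assms by (intro abelian_group_hom_intro)
    (auto simp: lsmult_closed lsmult_l_distr M.abelian_group_axioms A.abelian_group_axioms)

lemma (in left_module) lsmult_r_null: "a \<in> carrier A \<Longrightarrow> a \<odot>\<^bsub>M\<^esub> \<zero>\<^bsub>M\<^esub> = \<zero>\<^bsub>M\<^esub>"
  using abelian_group_hom.hom_zero[OF lsmult_hom] by simp

lemma (in left_module) lsmult_neg_one:
  assumes "x \<in> carrier M" shows "(\<ominus>\<^bsub>A\<^esub> \<one>\<^bsub>A\<^esub>) \<odot>\<^bsub>M\<^esub> x = \<ominus>\<^bsub>M\<^esub> x"
  using abelian_group_hom.hom_a_inv[OF lsmult_orbit_hom[OF assms] A.one_closed] assms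
  by (simp add: lsmult_one)


lemma linear_maps_minus:
  assumes "left_module A M" "left_module A N" "h \<in> linear_maps A M N" "x \<in> carrier M" "y \<in> carrier M"
  shows "h (x \<ominus>\<^bsub>M\<^esub> y) = h x \<ominus>\<^bsub>N\<^esub> h y"
proof -
  interpret h: abelian_group_hom M N h using assms(1-3) by (rule linear_maps_hom)
  show ?thesis using assms(4,5) by (simp add: a_minus_def)
qed

lemma linear_maps_cong:
  assumes "left_module A M" "\<And>x. x \<in> carrier M \<Longrightarrow> f x = g x"
  shows "f \<in> linear_maps A M N \<longleftrightarrow> g \<in> linear_maps A M N"
proof -
  interpret left_module A M by fact
  show ?thesis
    by (auto simp: linear_maps_def assms(2) lsmult_closed Pi_iff)
qed

lemma linear_maps_sum:
  assumes "left_module A M" "left_module A N" "f \<in> linear_maps A M N" "g \<in> linear_maps A M N"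
  shows "(\<lambda>x. f x \<oplus>\<^bsub>N\<^esub> g x) \<in> linear_maps A M N"
proof -
  interpret N: left_module A N by fact
  note f = assms(3) and g = assms(4)
  show ?thesis
    by (rule linear_mapsI)
      (simp_all add: linear_maps_closed[OF f] linear_maps_closed[OF g] linear_maps_add[OF f]
        linear_maps_add[OF g] linear_maps_smult[OF f] linear_maps_smult[OF g]
        N.lsmult_r_distr N.M.a_ac)
qed

text \<open>
  A linear combination of linear maps is linear only over a commutative ring: the coefficients
  have to be moved past the scalar.
\<close>

lemma linear_maps_finsum:
  assumes "cring K" "left_module K V" "left_module K W"
    and "\<And>y. y \<in> J \<Longrightarrow> c y \<in> carrier K" "\<And>y. y \<in> J \<Longrightarrow> F y \<in> linear_maps K V W"
  shows "(\<lambda>x. \<Oplus>\<^bsub>W\<^esub>y\<in>J. c y \<odot>\<^bsub>W\<^esub> F y x) \<in> linear_maps K V W"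
proof -
  interpret K: cring K by fact
  interpret V: left_module K V by fact
  interpret W: left_module K W by fact
  have cl: "c y \<odot>\<^bsub>W\<^esub> F y x \<in> carrier W" if "y \<in> J" "x \<in> carrier V" for x y
    using that assms by (auto intro!: W.lsmult_closed linear_maps_closed[OF assms(5)])
  show ?thesis
  proof (rule linear_mapsI)
    fix x y assume xy: "x \<in> carrier V" "y \<in> carrier V"
    have "(\<Oplus>\<^bsub>W\<^esub>z\<in>J. c z \<odot>\<^bsub>W\<^esub> F z (x \<oplus>\<^bsub>V\<^esub> y)) = (\<Oplus>\<^bsub>W\<^esub>z\<in>J. c z \<odot>\<^bsub>W\<^esub> F z x \<oplus>\<^bsub>W\<^esub> c z \<odot>\<^bsub>W\<^esub> F z y)"
      using xy by (intro W.finsum_cong') (auto simp: cl linear_maps_add[OF assms(5)] assms(4)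
          linear_maps_closed[OF assms(5)] W.lsmult_r_distr)
    also have "\<dots> = (\<Oplus>\<^bsub>W\<^esub>z\<in>J. c z \<odot>\<^bsub>W\<^esub> F z x) \<oplus>\<^bsub>W\<^esub> (\<Oplus>\<^bsub>W\<^esub>z\<in>J. c z \<odot>\<^bsub>W\<^esub> F z y)"
      using xy by (intro W.finsum_addf) (auto simp: cl)
    finally show "(\<Oplus>\<^bsub>W\<^esub>z\<in>J. c z \<odot>\<^bsub>W\<^esub> F z (x \<oplus>\<^bsub>V\<^esub> y)) = \<dots>" .
  next
    fix a x assume ax: "a \<in> carrier K" "x \<in> carrier V"
    have "c z \<odot>\<^bsub>W\<^esub> (a \<odot>\<^bsub>W\<^esub> w) = a \<odot>\<^bsub>W\<^esub> (c z \<odot>\<^bsub>W\<^esub> w)" if "z \<in> J" "w \<in> carrier W" for z w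
      using that ax assms(4) by (metis K.m_comm W.lsmult_assoc)
    then have "(\<Oplus>\<^bsub>W\<^esub>z\<in>J. c z \<odot>\<^bsub>W\<^esub> F z (a \<odot>\<^bsub>V\<^esub> x)) = (\<Oplus>\<^bsub>W\<^esub>z\<in>J. a \<odot>\<^bsub>W\<^esub> (c z \<odot>\<^bsub>W\<^esub> F z x))"
      using ax by (intro W.finsum_cong') (auto simp: cl linear_maps_smult[OF assms(5)]
          linear_maps_closed[OF assms(5)] W.lsmult_closed)
    also have "\<dots> = a \<odot>\<^bsub>W\<^esub> (\<Oplus>\<^bsub>W\<^esub>z\<in>J. c z \<odot>\<^bsub>W\<^esub> F z x)"
      using ax by (subst abelian_group_hom.hom_finsum[OF W.lsmult_hom[OF ax(1)]]) (auto simp: cl)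
    finally show "(\<Oplus>\<^bsub>W\<^esub>z\<in>J. c z \<odot>\<^bsub>W\<^esub> F z (a \<odot>\<^bsub>V\<^esub> x)) = \<dots>" .
  qed (auto simp: cl)
qed

lemma (in cring) scalar_linear:
  assumes "left_module R M" "c \<in> carrier R"
  shows "(\<lambda>x. c \<odot>\<^bsub>M\<^esub> x) \<in> linear_maps R M M"
proof -
  interpret M: left_module R M by fact
  have "c \<odot>\<^bsub>M\<^esub> (a \<odot>\<^bsub>M\<^esub> x) = a \<odot>\<^bsub>M\<^esub> (c \<odot>\<^bsub>M\<^esub> x)" if "a \<in> carrier R" "x \<in> carrier M" for a x
    using that assms(2) by (metis M.lsmult_assoc m_comm)
  then show ?thesis
    by (intro linear_mapsI) (simp_all add: assms(2) M.lsmult_closed M.lsmult_r_distr)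
qed


section \<open>Submodules\<close>

text \<open>
  Closure under negatives is implied by closure under the action of \<open>- 1\<close>.
\<close>

lemma (in left_module) submodule_intro:
  assumes "H \<subseteq> carrier M" "\<zero>\<^bsub>M\<^esub> \<in> H"
    and "\<And>x y. \<lbrakk>x \<in> H; y \<in> H\<rbrakk> \<Longrightarrow> x \<oplus>\<^bsub>M\<^esub> y \<in> H"
    and "\<And>a x. \<lbrakk>a \<in> carrier A; x \<in> H\<rbrakk> \<Longrightarrow> a \<odot>\<^bsub>M\<^esub> x \<in> H"
  shows "submodule H A M"
proof -
  have "\<ominus>\<^bsub>M\<^esub> x \<in> H" if "x \<in> H" for x
    using assms(4)[of "\<ominus>\<^bsub>A\<^esub> \<one>\<^bsub>A\<^esub>" x] that assms(1) lsmult_neg_one by auto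
  then show ?thesis
    using assms unfolding submodule_def submodule_axioms_def
    by (auto intro!: subgroup.intro simp: a_inv_def)
qed

lemma submodule_subset: "submodule N A M \<Longrightarrow> N \<subseteq> carrier M"
  and submodule_zero: "submodule N A M \<Longrightarrow> \<zero>\<^bsub>M\<^esub> \<in> N"
  and submodule_add: "\<lbrakk>submodule N A M; x \<in> N; y \<in> N\<rbrakk> \<Longrightarrow> x \<oplus>\<^bsub>M\<^esub> y \<in> N"
  and submodule_smult: "\<lbrakk>submodule N A M; a \<in> carrier A; x \<in> N\<rbrakk> \<Longrightarrow> a \<odot>\<^bsub>M\<^esub> x \<in> N"
  unfolding submodule_def submodule_axioms_def subgroup_def by auto

lemma submodule_preimage:
  assumes "left_module A M" "left_module A W" "h \<in> linear_maps A M W" "submodule N A W"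
  shows "submodule {x \<in> carrier M. h x \<in> N} A M"
proof -
  interpret M: left_module A M by fact
  show ?thesis
    by (rule M.submodule_intro)
      (auto simp: linear_maps_zero[OF assms(1-3)] linear_maps_add[OF assms(3)] M.lsmult_closed
        linear_maps_smult[OF assms(3)] submodule_zero[OF assms(4)] submodule_add[OF assms(4)]
        submodule_smult[OF assms(4)])
qed

lemma submodule_equalizer:
  assumes "left_module A M" "left_module A W" "f \<in> linear_maps A M W" "g \<in> linear_maps A M W"
  shows "submodule {x \<in> carrier M. f x = g x} A M"
proof -
  interpret M: left_module A M by fact
  show ?thesis
    by (rule M.submodule_intro)
      (auto simp: linear_maps_zero[OF assms(1,2,3)] linear_maps_zero[OF assms(1,2,4)]
        linear_maps_add[OF assms(3)] linear_maps_add[OF assms(4)]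
        linear_maps_smult[OF assms(3)] linear_maps_smult[OF assms(4)] M.lsmult_closed)
qed

lemma submodule_kernel:
  assumes "left_module A M" "left_module A W" "f \<in> linear_maps A M W"
  shows "submodule {x \<in> carrier M. f x = \<zero>\<^bsub>W\<^esub>} A M"
proof -
  interpret M: left_module A M by fact
  interpret W: left_module A W by fact
  show ?thesis
    by (rule M.submodule_intro)
      (auto simp: linear_maps_zero[OF assms] linear_maps_add[OF assms(3)] W.lsmult_r_null
         linear_maps_smult[OF assms(3)] M.lsmult_closed)
qed

lemma (in left_module) submodule_carrier: "submodule (carrier M) A M"
  by (rule submodule_intro) (auto simp: lsmult_closed)

lemma (in left_module) submodule_Inter:
  assumes "\<N> \<noteq> {}" "\<And>N. N \<in> \<N> \<Longrightarrow> submodule N A M"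
  shows "submodule (\<Inter>\<N>) A M"
proof (rule submodule_intro)
  show "\<Inter>\<N> \<subseteq> carrier M" using assms(1) submodule_subset[OF assms(2)] by blast
qed (auto intro: submodule_zero[OF assms(2)] submodule_add[OF assms(2)] submodule_smult[OF assms(2)])

lemma submodule_submodule_span:
  assumes "left_module A M" "S \<subseteq> carrier M"
  shows "submodule (submodule_span A M S) A M"
  unfolding submodule_span_def
  using assms left_module.submodule_carrier
  by (intro left_module.submodule_Inter[OF assms(1)]) auto

lemma submodule_span_superset: "S \<subseteq> submodule_span A M S"
  and submodule_span_least: "\<lbrakk>submodule N A M; S \<subseteq> N\<rbrakk> \<Longrightarrow> submodule_span A M S \<subseteq> N"
  unfolding submodule_span_def by auto

lemma (in left_module) submodule_imp_abelian_subgroup: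
  assumes "submodule N A M" shows "abelian_subgroup N M"
  using assms M.abelian_group_axioms
  by (intro abelian_subgroupI3) (auto simp: submodule_def additive_subgroup_def)


section \<open>Quotient modules\<close>

lemma quotient_module_simps [simp]:
  "carrier (quotient_module M N) = a_rcosets\<^bsub>M\<^esub> N"
  "zero (quotient_module M N) = N"
  "add (quotient_module M N) = set_add M"
  "smult (quotient_module M N) a = coset_map M N (\<lambda>x. a \<odot>\<^bsub>M\<^esub> x)"
  by (simp_all add: quotient_module_def)

lemma a_rcosets_eq_image: "a_rcosets\<^bsub>M\<^esub> N = (\<lambda>x. N +>\<^bsub>M\<^esub> x) ` carrier M"
  unfolding A_RCOSETS_def' a_r_coset_def' by auto

text \<open>
  The union that defines \<^const>\<open>coset_map\<close> has equal members when \<open>h\<close> maps one subgroup into the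
  other. The map is additive rather than linear because the lemma is applied to the action of an
  element of a noncommutative ring.
\<close>

lemma coset_map_coset:
  assumes "abelian_group_hom M W h" "abelian_subgroup N M" "abelian_subgroup N' W"
    and "\<And>x. x \<in> N \<Longrightarrow> h x \<in> N'" and "x \<in> carrier M"
  shows "coset_map W N' h (N +>\<^bsub>M\<^esub> x) = N' +>\<^bsub>W\<^esub> h x"
proof -
  interpret h: abelian_group_hom M W h by fact
  interpret N: abelian_subgroup N M by fact
  interpret N': abelian_subgroup N' W by fact
  have "N' +>\<^bsub>W\<^esub> h c = N' +>\<^bsub>W\<^esub> h x" if c: "c \<in> N +>\<^bsub>M\<^esub> x" for c
  proof -
    obtain n where n: "n \<in> N" "c = n \<oplus>\<^bsub>M\<^esub> x"
      using c unfolding a_r_coset_def' by auto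
    then have "h c = h n \<oplus>\<^bsub>W\<^esub> h x" using assms(5) by auto
    then have "h c \<in> N' +>\<^bsub>W\<^esub> h x"
      using assms(4)[OF n(1)] unfolding a_r_coset_def' by auto
    then show ?thesis
      using N'.a_repr_independence' N'.a_subgroup assms(5) by auto
  qed
  moreover have "x \<in> N +>\<^bsub>M\<^esub> x" using N.a_rcos_self assms(5) by auto
  ultimately show ?thesis unfolding coset_map_def by blast
qed

context
  fixes A :: "('a, 'p) ring_scheme" and M :: "('a, 'm) module" and N :: "'m set"
  assumes M: "left_module A M" and N: "submodule N A M"
begin

interpretation left_module A M by (fact M)

interpretation N: abelian_subgroup N M
  using N by (rule submodule_imp_abelian_subgroup)

lemma quotient_smult_coset:
  assumes "a \<in> carrier A" "x \<in> carrier M"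
  shows "a \<odot>\<^bsub>quotient_module M N\<^esub> (N +>\<^bsub>M\<^esub> x) = N +>\<^bsub>M\<^esub> (a \<odot>\<^bsub>M\<^esub> x)"
  using coset_map_coset[OF lsmult_hom N.is_abelian_subgroup N.is_abelian_subgroup]
    submodule_smult[OF N] assms by simp

lemma quotient_left_module: "left_module A (quotient_module M N)"
proof -
  have ag: "abelian_group (quotient_module M N)"
    using N.a_factorgroup_is_comm_group
    by (intro comm_group_imp_abelian_group) (auto simp: A_FactGroup_def')
  show ?thesis
    unfolding left_module_def left_module_axioms_def
    using A.ring_axioms ag
    by (auto simp: a_rcosets_eq_image N.a_rcos_sum lsmult_closed quotient_smult_coset[simplified]
        lsmult_l_distr lsmult_r_distr lsmult_assoc lsmult_one)
qed

lemma coset_linear: "(\<lambda>x. N +>\<^bsub>M\<^esub> x) \<in> linear_maps A M (quotient_module M N)"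
  by (rule linear_mapsI)
    (auto simp: a_rcosets_eq_image N.a_rcos_sum quotient_smult_coset[simplified])

lemma coset_eq_zero:
  assumes "x \<in> N" shows "N +>\<^bsub>M\<^esub> x = N"
  using assms M.a_coset_join2 N.a_subgroup N.a_Hcarr by blast

text \<open>
  The descended map evaluates \<open>g\<close> at an arbitrary element of the coset, as \<open>g\<close> is constant on cosets.
\<close>

lemma quotient_universal:
  assumes W: "left_module A W" and g: "g \<in> linear_maps A M W"
    and ker: "\<And>x. x \<in> N \<Longrightarrow> g x = \<zero>\<^bsub>W\<^esub>"
  obtains h where "h \<in> linear_maps A (quotient_module M N) W"
    and "\<And>x. x \<in> carrier M \<Longrightarrow> h (N +>\<^bsub>M\<^esub> x) = g x"
proof -
  interpret W: left_module A W by fact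
  define h where "h C = g (SOME c. c \<in> C)" for C
  have h: "h (N +>\<^bsub>M\<^esub> x) = g x" if x: "x \<in> carrier M" for x
  proof -
    have "(SOME c. c \<in> N +>\<^bsub>M\<^esub> x) \<in> N +>\<^bsub>M\<^esub> x"
      using N.a_rcos_self[OF x] by (rule someI)
    then obtain n where "n \<in> N" "(SOME c. c \<in> N +>\<^bsub>M\<^esub> x) = n \<oplus>\<^bsub>M\<^esub> x"
      unfolding a_r_coset_def' by auto
    then show ?thesis
      using x by (simp add: h_def linear_maps_add[OF g] ker linear_maps_closed[OF g])
  qed
  have "h \<in> linear_maps A (quotient_module M N) W"
    by (rule linear_mapsI)
      (auto simp: a_rcosets_eq_image h linear_maps_closed[OF g] N.a_rcos_sum
        linear_maps_add[OF g] linear_maps_smult[OF g] quotient_smult_coset[simplified] lsmult_closed)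
  then show thesis using that h by blast
qed

end

lemma coset_eq_zero_iff:
  fixes M :: "('a, 'm) module"
  assumes "left_module A M" "submodule N A M" "x \<in> carrier M"
  shows "N +>\<^bsub>M\<^esub> x = N \<longleftrightarrow> x \<in> N"
  using coset_eq_zero[OF assms(1,2)] assms(3)
    abelian_subgroup.a_rcos_self[OF left_module.submodule_imp_abelian_subgroup[OF assms(1,2)]]
  by blast

lemma coset_map_linear:
  assumes M: "left_module A M" and W: "left_module A W"
    and N: "submodule N A M" and N': "submodule N' A W"
    and h: "h \<in> linear_maps A M W" and sub: "\<And>x. x \<in> N \<Longrightarrow> h x \<in> N'"
  shows "coset_map W N' h \<in> linear_maps A (quotient_module M N) (quotient_module W N')"
    and "\<And>x. x \<in> carrier M \<Longrightarrow> coset_map W N' h (N +>\<^bsub>M\<^esub> x) = N' +>\<^bsub>W\<^esub> h x"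
proof -
  interpret M: left_module A M by fact
  interpret W: left_module A W by fact
  have coset: "coset_map W N' h (N +>\<^bsub>M\<^esub> x) = N' +>\<^bsub>W\<^esub> h x" if "x \<in> carrier M" for x
    using coset_map_coset[OF linear_maps_hom[OF M W h] M.submodule_imp_abelian_subgroup[OF N]
        W.submodule_imp_abelian_subgroup[OF N']] sub that by blast
  obtain g where g: "g \<in> linear_maps A (quotient_module M N) (quotient_module W N')"
    and gh: "\<And>x. x \<in> carrier M \<Longrightarrow> g (N +>\<^bsub>M\<^esub> x) = N' +>\<^bsub>W\<^esub> h x"
    using quotient_universal[OF M N quotient_left_module[OF W N']
        linear_maps_comp[OF h coset_linear[OF W N']]] coset_eq_zero[OF W N'] sub
    by (metis quotient_module_simps(2))
  have eq: "coset_map W N' h C = g C" if "C \<in> carrier (quotient_module M N)" for C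
    using that coset gh by (auto simp: a_rcosets_eq_image)
  interpret Q: left_module A "quotient_module M N" by (rule quotient_left_module[OF M N])
  show "coset_map W N' h \<in> linear_maps A (quotient_module M N) (quotient_module W N')"
    by (rule linear_mapsI)
      (simp_all only: eq Q.M.a_closed Q.lsmult_closed linear_maps_closed[OF g]
        linear_maps_add[OF g] linear_maps_smult[OF g])
  show "\<And>x. x \<in> carrier M \<Longrightarrow> coset_map W N' h (N +>\<^bsub>M\<^esub> x) = N' +>\<^bsub>W\<^esub> h x"
    by (rule coset)
qed


section \<open>Direct sums and free modules\<close>

lemma direct_sum_carrier:
  "carrier (direct_sum I V) = {f \<in> (\<Pi>\<^sub>E i\<in>I. carrier (V i)). finite {i \<in> I. f i \<noteq> \<zero>\<^bsub>V i\<^esub>}}"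
  by (simp add: direct_sum_def)

lemma direct_sum_component: "\<lbrakk>f \<in> carrier (direct_sum I V); i \<in> I\<rbrakk> \<Longrightarrow> f i \<in> carrier (V i)"
  and direct_sum_finite_support:
    "f \<in> carrier (direct_sum I V) \<Longrightarrow> finite {i \<in> I. f i \<noteq> \<zero>\<^bsub>V i\<^esub>}"
  and direct_sum_ext:
    "\<lbrakk>f \<in> carrier (direct_sum I V); g \<in> carrier (direct_sum I V); \<And>i. i \<in> I \<Longrightarrow> f i = g i\<rbrakk> \<Longrightarrow> f = g"
  by (auto simp: direct_sum_carrier intro: PiE_ext)

lemma direct_sum_simps [simp]:
  "zero (direct_sum I V) = (\<lambda>i\<in>I. \<zero>\<^bsub>V i\<^esub>)"
  "add (direct_sum I V) f g = (\<lambda>i\<in>I. f i \<oplus>\<^bsub>V i\<^esub> g i)"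
  "smult (direct_sum I V) a f = (\<lambda>i\<in>I. a \<odot>\<^bsub>V i\<^esub> f i)"
  by (simp_all add: direct_sum_def)

definition direct_sum_incl :: "'i set \<Rightarrow> ('i \<Rightarrow> ('a, 'm) module) \<Rightarrow> 'i \<Rightarrow> 'm \<Rightarrow> 'i \<Rightarrow> 'm"
  where "direct_sum_incl I V i x = (\<lambda>j\<in>I. if j = i then x else \<zero>\<^bsub>V j\<^esub>)"

definition direct_sum_lift ::
    "'i set \<Rightarrow> ('i \<Rightarrow> ('a, 'm) module) \<Rightarrow> ('a, 'n) module \<Rightarrow> ('i \<Rightarrow> 'm \<Rightarrow> 'n) \<Rightarrow> ('i \<Rightarrow> 'm) \<Rightarrow> 'n"
  where "direct_sum_lift I V W g f = (\<Oplus>\<^bsub>W\<^esub>i\<in>{i \<in> I. f i \<noteq> \<zero>\<^bsub>V i\<^esub>}. g i (f i))"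

locale module_family = ring A for A :: "('a, 'p) ring_scheme" +
  fixes I :: "'i set" and V :: "'i \<Rightarrow> ('a, 'm) module"
  assumes family: "i \<in> I \<Longrightarrow> left_module A (V i)"
begin

lemmas component = direct_sum_component[of _ I V]

lemma family_simps:
  assumes "i \<in> I"
  shows "\<zero>\<^bsub>V i\<^esub> \<in> carrier (V i)"
    "\<lbrakk>x \<in> carrier (V i); y \<in> carrier (V i)\<rbrakk> \<Longrightarrow> x \<oplus>\<^bsub>V i\<^esub> y \<in> carrier (V i)"
    "x \<in> carrier (V i) \<Longrightarrow> \<ominus>\<^bsub>V i\<^esub> x \<in> carrier (V i)"
    "x \<in> carrier (V i) \<Longrightarrow> x \<oplus>\<^bsub>V i\<^esub> \<zero>\<^bsub>V i\<^esub> = x"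
    "x \<in> carrier (V i) \<Longrightarrow> \<zero>\<^bsub>V i\<^esub> \<oplus>\<^bsub>V i\<^esub> x = x"
    "x \<in> carrier (V i) \<Longrightarrow> \<ominus>\<^bsub>V i\<^esub> x \<oplus>\<^bsub>V i\<^esub> x = \<zero>\<^bsub>V i\<^esub>"
    "\<ominus>\<^bsub>V i\<^esub> \<zero>\<^bsub>V i\<^esub> = \<zero>\<^bsub>V i\<^esub>"
    "\<lbrakk>a \<in> carrier A; x \<in> carrier (V i)\<rbrakk> \<Longrightarrow> a \<odot>\<^bsub>V i\<^esub> x \<in> carrier (V i)"
    "a \<in> carrier A \<Longrightarrow> a \<odot>\<^bsub>V i\<^esub> \<zero>\<^bsub>V i\<^esub> = \<zero>\<^bsub>V i\<^esub>"
proof -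
  interpret left_module A "V i" using family[OF assms] .
  show "\<zero>\<^bsub>V i\<^esub> \<in> carrier (V i)"
    "\<lbrakk>x \<in> carrier (V i); y \<in> carrier (V i)\<rbrakk> \<Longrightarrow> x \<oplus>\<^bsub>V i\<^esub> y \<in> carrier (V i)"
    "x \<in> carrier (V i) \<Longrightarrow> \<ominus>\<^bsub>V i\<^esub> x \<in> carrier (V i)"
    "x \<in> carrier (V i) \<Longrightarrow> x \<oplus>\<^bsub>V i\<^esub> \<zero>\<^bsub>V i\<^esub> = x"
    "x \<in> carrier (V i) \<Longrightarrow> \<zero>\<^bsub>V i\<^esub> \<oplus>\<^bsub>V i\<^esub> x = x"
    "x \<in> carrier (V i) \<Longrightarrow> \<ominus>\<^bsub>V i\<^esub> x \<oplus>\<^bsub>V i\<^esub> x = \<zero>\<^bsub>V i\<^esub>"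
    "\<ominus>\<^bsub>V i\<^esub> \<zero>\<^bsub>V i\<^esub> = \<zero>\<^bsub>V i\<^esub>"
    "\<lbrakk>a \<in> carrier A; x \<in> carrier (V i)\<rbrakk> \<Longrightarrow> a \<odot>\<^bsub>V i\<^esub> x \<in> carrier (V i)"
    "a \<in> carrier A \<Longrightarrow> a \<odot>\<^bsub>V i\<^esub> \<zero>\<^bsub>V i\<^esub> = \<zero>\<^bsub>V i\<^esub>"
    by (auto simp: lsmult_closed lsmult_r_null M.l_neg)
qed

lemma direct_sum_closedI:
  assumes "\<And>i. i \<in> I \<Longrightarrow> f i \<in> carrier (V i)" "finite J" "\<And>i. i \<in> I - J \<Longrightarrow> f i = \<zero>\<^bsub>V i\<^esub>"
  shows "(\<lambda>i\<in>I. f i) \<in> carrier (direct_sum I V)"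
proof -
  have "finite {i \<in> I. (\<lambda>i\<in>I. f i) i \<noteq> \<zero>\<^bsub>V i\<^esub>}"
    by (rule finite_subset[OF _ assms(2)]) (use assms(3) in auto)
  then show ?thesis using assms(1) by (auto simp: direct_sum_carrier)
qed

lemma direct_sum_add_closed:
  assumes "f \<in> carrier (direct_sum I V)" "g \<in> carrier (direct_sum I V)"
  shows "f \<oplus>\<^bsub>direct_sum I V\<^esub> g \<in> carrier (direct_sum I V)"
proof -
  have fin: "finite ({i \<in> I. f i \<noteq> \<zero>\<^bsub>V i\<^esub>} \<union> {i \<in> I. g i \<noteq> \<zero>\<^bsub>V i\<^esub>})"
    using assms by (auto dest: direct_sum_finite_support)
  show ?thesis
    unfolding direct_sum_simps(2)
    by (rule direct_sum_closedI[OF _ fin]) (use assms in \<open>auto simp: family_simps component\<close>)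
qed

lemma direct_sum_smult_closed:
  assumes "a \<in> carrier A" "f \<in> carrier (direct_sum I V)"
  shows "a \<odot>\<^bsub>direct_sum I V\<^esub> f \<in> carrier (direct_sum I V)"
proof -
  have fin: "finite {i \<in> I. f i \<noteq> \<zero>\<^bsub>V i\<^esub>}"
    using assms by (auto dest: direct_sum_finite_support)
  show ?thesis
    unfolding direct_sum_simps(3)
    by (rule direct_sum_closedI[OF _ fin]) (use assms in \<open>auto simp: family_simps component\<close>)
qed

lemma direct_sum_zero_closed: "\<zero>\<^bsub>direct_sum I V\<^esub> \<in> carrier (direct_sum I V)"
  unfolding direct_sum_simps(1) by (rule direct_sum_closedI[of _ "{}"]) (auto simp: family_simps)

lemma direct_sum_neg_closed:
  assumes "f \<in> carrier (direct_sum I V)"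
  shows "(\<lambda>i\<in>I. \<ominus>\<^bsub>V i\<^esub> f i) \<in> carrier (direct_sum I V)"
proof -
  have fin: "finite {i \<in> I. f i \<noteq> \<zero>\<^bsub>V i\<^esub>}"
    using assms by (auto dest: direct_sum_finite_support)
  show ?thesis
    by (rule direct_sum_closedI[OF _ fin]) (use assms in \<open>auto simp: family_simps component\<close>)
qed

lemma direct_sum_left_module: "left_module A (direct_sum I V)"
proof -
  have V: "abelian_group (V i)" if "i \<in> I" for i
    using family[OF that] by (simp add: left_module_def)
  have "abelian_group (direct_sum I V)"
  proof (rule abelian_groupI)
    fix x assume x: "x \<in> carrier (direct_sum I V)"
    show "\<exists>y\<in>carrier (direct_sum I V). y \<oplus>\<^bsub>direct_sum I V\<^esub> x = \<zero>\<^bsub>direct_sum I V\<^esub>"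
      by (rule bexI[OF _ direct_sum_neg_closed[OF x]]) (auto simp: fun_eq_iff family_simps component[OF x])
  next
    fix x y z assume xyz: "x \<in> carrier (direct_sum I V)" "y \<in> carrier (direct_sum I V)"
      "z \<in> carrier (direct_sum I V)"
    show "x \<oplus>\<^bsub>direct_sum I V\<^esub> y \<oplus>\<^bsub>direct_sum I V\<^esub> z = x \<oplus>\<^bsub>direct_sum I V\<^esub> (y \<oplus>\<^bsub>direct_sum I V\<^esub> z)"
      by (auto simp: fun_eq_iff abelian_monoid.a_assoc[OF abelian_group.axioms(1)[OF V]]
          component xyz)
  next
    fix x y assume xy: "x \<in> carrier (direct_sum I V)" "y \<in> carrier (direct_sum I V)"
    show "x \<oplus>\<^bsub>direct_sum I V\<^esub> y = y \<oplus>\<^bsub>direct_sum I V\<^esub> x"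
      by (auto simp: fun_eq_iff abelian_monoid.a_comm[OF abelian_group.axioms(1)[OF V]]
          component xy)
  next
    fix x assume x: "x \<in> carrier (direct_sum I V)"
    show "\<zero>\<^bsub>direct_sum I V\<^esub> \<oplus>\<^bsub>direct_sum I V\<^esub> x = x"
      by (rule direct_sum_ext[OF direct_sum_add_closed[OF direct_sum_zero_closed x] x])
        (simp add: family_simps component[OF x])
  qed (rule direct_sum_add_closed direct_sum_zero_closed; assumption?)+
  moreover have "left_module_axioms A (direct_sum I V)"
  proof
    fix x assume x: "x \<in> carrier (direct_sum I V)"
    show "\<one>\<^bsub>A\<^esub> \<odot>\<^bsub>direct_sum I V\<^esub> x = x"
      by (rule direct_sum_ext[OF direct_sum_smult_closed[OF one_closed x] x])
        (simp add: left_module.lsmult_one[OF family] component[OF x])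
  qed (auto simp: direct_sum_smult_closed[unfolded direct_sum_simps] fun_eq_iff component left_module.lsmult_l_distr[OF family]
      left_module.lsmult_r_distr[OF family] left_module.lsmult_assoc[OF family] family_simps
     )
  ultimately show ?thesis by (simp add: left_module_def ring_axioms)
qed

lemma direct_sum_incl_linear:
  assumes "i \<in> I"
  shows "direct_sum_incl I V i \<in> linear_maps A (V i) (direct_sum I V)"
proof (rule linear_mapsI)
  show "direct_sum_incl I V i x \<in> carrier (direct_sum I V)" if "x \<in> carrier (V i)" for x
    unfolding direct_sum_incl_def
    by (rule direct_sum_closedI[of _ "{i}"]) (use that in \<open>auto simp: family_simps\<close>)
qed (auto simp: direct_sum_incl_def fun_eq_iff family_simps)

text \<open>
  An element is the sum of its finitely many components, so induction on the support applies.
  As \<open>N\<close> is only a set closed under addition, the lemma applies to submodules over \<open>A\<close> as well as to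
  submodules over a ring to which the scalars are restricted.
\<close>

lemma direct_sum_generated:
  assumes zero: "\<zero>\<^bsub>direct_sum I V\<^esub> \<in> N"
    and add: "\<And>f g. \<lbrakk>f \<in> N; g \<in> N\<rbrakk> \<Longrightarrow> f \<oplus>\<^bsub>direct_sum I V\<^esub> g \<in> N"
    and incl: "\<And>i x. \<lbrakk>i \<in> I; x \<in> carrier (V i)\<rbrakk> \<Longrightarrow> direct_sum_incl I V i x \<in> N"
  shows "carrier (direct_sum I V) \<subseteq> N"
proof -
  have gen: "f \<in> N" if "finite J" "f \<in> carrier (direct_sum I V)" "{i \<in> I. f i \<noteq> \<zero>\<^bsub>V i\<^esub>} \<subseteq> J" for f J
    using that
  proof (induction J arbitrary: f)
    case (empty f)
    have "f = \<zero>\<^bsub>direct_sum I V\<^esub>"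
      by (rule direct_sum_ext[OF empty(1) direct_sum_zero_closed]) (use empty(2) in auto)
    then show ?case using zero by (simp only:)
  next
    case (insert k J f)
    note f = insert.prems(1) and supp = insert.prems(2)
    show ?case
    proof (cases "k \<in> I")
      case False
      then have "{i \<in> I. f i \<noteq> \<zero>\<^bsub>V i\<^esub>} \<subseteq> J" using supp by auto
      then show ?thesis by (rule insert.IH[OF f])
    next
      case True
      define g where "g = (\<lambda>i\<in>I. if i = k then \<zero>\<^bsub>V i\<^esub> else f i)"
      have g: "g \<in> carrier (direct_sum I V)"
        unfolding g_def
        by (rule direct_sum_closedI[of _ J]) (use insert.hyps supp in \<open>auto simp: family_simps component[OF f]\<close>)
      have "{i \<in> I. g i \<noteq> \<zero>\<^bsub>V i\<^esub>} \<subseteq> J" using supp by (auto simp: g_def)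
      then have gN: "g \<in> N" by (rule insert.IH[OF g])
      have fk: "f k \<in> carrier (V k)" using f True by (rule component)
      have "direct_sum_incl I V k (f k) \<oplus>\<^bsub>direct_sum I V\<^esub> g \<in> N"
        by (rule add[OF incl[OF True fk] gN])
      also have "direct_sum_incl I V k (f k) \<oplus>\<^bsub>direct_sum I V\<^esub> g = f"
      proof (rule direct_sum_ext[OF direct_sum_add_closed f])
        show "direct_sum_incl I V k (f k) \<in> carrier (direct_sum I V)"
          using direct_sum_incl_linear[OF True] fk by (rule linear_maps_closed)
        show "g \<in> carrier (direct_sum I V)" by (rule g)
        show "(direct_sum_incl I V k (f k) \<oplus>\<^bsub>direct_sum I V\<^esub> g) i = f i" if "i \<in> I" for i
          using that fk by (auto simp: direct_sum_incl_def g_def family_simps component[OF f])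
      qed
      finally show ?thesis .
    qed
  qed
  show "carrier (direct_sum I V) \<subseteq> N"
  proof (intro subsetI)
    fix f assume "f \<in> carrier (direct_sum I V)"
    from gen[OF direct_sum_finite_support[OF this] this] show "f \<in> N" by simp
  qed
qed

context
  fixes W :: "('a, 'n) module" and g :: "'i \<Rightarrow> 'm \<Rightarrow> 'n"
  assumes W: "left_module A W" and g: "\<And>i. i \<in> I \<Longrightarrow> g i \<in> linear_maps A (V i) W"
begin

interpretation W: left_module A W by (fact W)

text \<open>
  Summing over any finite set that contains the support gives the same value; sums over the supports
  of two elements can thus be compared over their union.
\<close>

lemma direct_sum_lift_eq:
  assumes "f \<in> carrier (direct_sum I V)" "finite J" "J \<subseteq> I" "{i \<in> I. f i \<noteq> \<zero>\<^bsub>V i\<^esub>} \<subseteq> J"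
  shows "direct_sum_lift I V W g f = (\<Oplus>\<^bsub>W\<^esub>i\<in>J. g i (f i))"
  unfolding direct_sum_lift_def
  using assms linear_maps_zero[OF family W g]
  by (intro W.add.finprod_mono_neutral_cong_left) (auto intro!: linear_maps_closed[OF g] component)

lemma direct_sum_lift_linear:
  "direct_sum_lift I V W g \<in> linear_maps A (direct_sum I V) W"
proof (rule linear_mapsI)
  fix x assume "x \<in> carrier (direct_sum I V)"
  then show "direct_sum_lift I V W g x \<in> carrier W"
    unfolding direct_sum_lift_def by (auto intro!: W.finsum_closed linear_maps_closed[OF g] component)
next
  fix x y assume x: "x \<in> carrier (direct_sum I V)" and y: "y \<in> carrier (direct_sum I V)"
  define J where "J = {i \<in> I. x i \<noteq> \<zero>\<^bsub>V i\<^esub>} \<union> {i \<in> I. y i \<noteq> \<zero>\<^bsub>V i\<^esub>}"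
  have J: "finite J" "J \<subseteq> I" using x y by (auto simp: J_def direct_sum_finite_support)
  have xy: "{i \<in> I. (x \<oplus>\<^bsub>direct_sum I V\<^esub> y) i \<noteq> \<zero>\<^bsub>V i\<^esub>} \<subseteq> J"
    by (auto simp: J_def family_simps)
  have "direct_sum_lift I V W g (x \<oplus>\<^bsub>direct_sum I V\<^esub> y)
      = (\<Oplus>\<^bsub>W\<^esub>i\<in>J. g i ((x \<oplus>\<^bsub>direct_sum I V\<^esub> y) i))"
    by (rule direct_sum_lift_eq[OF direct_sum_add_closed[OF x y] J xy])
  also have "\<dots> = (\<Oplus>\<^bsub>W\<^esub>i\<in>J. g i (x i) \<oplus>\<^bsub>W\<^esub> g i (y i))"
    using J x y
    by (intro W.finsum_cong') (auto intro!: linear_maps_closed[OF g]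
        simp: subset_iff linear_maps_add[OF g] component)
  also have "\<dots> = (\<Oplus>\<^bsub>W\<^esub>i\<in>J. g i (x i)) \<oplus>\<^bsub>W\<^esub> (\<Oplus>\<^bsub>W\<^esub>i\<in>J. g i (y i))"
    using J x y by (intro W.finsum_addf) (auto intro!: linear_maps_closed[OF g] component)
  also have "\<dots> = direct_sum_lift I V W g x \<oplus>\<^bsub>W\<^esub> direct_sum_lift I V W g y"
    using direct_sum_lift_eq[OF x J] direct_sum_lift_eq[OF y J] by (simp add: J_def)
  finally show "direct_sum_lift I V W g (x \<oplus>\<^bsub>direct_sum I V\<^esub> y)
      = direct_sum_lift I V W g x \<oplus>\<^bsub>W\<^esub> direct_sum_lift I V W g y" .
next
  fix a x assume a: "a \<in> carrier A" and x: "x \<in> carrier (direct_sum I V)"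
  define J where "J = {i \<in> I. x i \<noteq> \<zero>\<^bsub>V i\<^esub>}"
  have J: "finite J" "J \<subseteq> I" using x by (auto simp: J_def direct_sum_finite_support)
  have ax: "{i \<in> I. (a \<odot>\<^bsub>direct_sum I V\<^esub> x) i \<noteq> \<zero>\<^bsub>V i\<^esub>} \<subseteq> J"
    using a by (auto simp: J_def family_simps)
  have "direct_sum_lift I V W g (a \<odot>\<^bsub>direct_sum I V\<^esub> x)
      = (\<Oplus>\<^bsub>W\<^esub>i\<in>J. g i ((a \<odot>\<^bsub>direct_sum I V\<^esub> x) i))"
    by (rule direct_sum_lift_eq[OF direct_sum_smult_closed[OF a x] J ax])
  also have "\<dots> = (\<Oplus>\<^bsub>W\<^esub>i\<in>J. a \<odot>\<^bsub>W\<^esub> g i (x i))"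
    using J x a
    by (intro W.finsum_cong') (auto intro!: W.lsmult_closed linear_maps_closed[OF g]
        simp: subset_iff linear_maps_smult[OF g] component)
  also have "\<dots> = a \<odot>\<^bsub>W\<^esub> (\<Oplus>\<^bsub>W\<^esub>i\<in>J. g i (x i))"
    using J x by (subst abelian_group_hom.hom_finsum[OF W.lsmult_hom[OF a]])
      (auto intro!: linear_maps_closed[OF g] component)
  also have "\<dots> = a \<odot>\<^bsub>W\<^esub> direct_sum_lift I V W g x"
    using direct_sum_lift_eq[OF x J] by (simp add: J_def)
  finally show "direct_sum_lift I V W g (a \<odot>\<^bsub>direct_sum I V\<^esub> x) = a \<odot>\<^bsub>W\<^esub> direct_sum_lift I V W g x" .
qed

lemma direct_sum_lift_incl:
  assumes "i \<in> I" "x \<in> carrier (V i)"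
  shows "direct_sum_lift I V W g (direct_sum_incl I V i x) = g i x"
proof -
  have "direct_sum_lift I V W g (direct_sum_incl I V i x)
      = (\<Oplus>\<^bsub>W\<^esub>j\<in>{i}. g j (direct_sum_incl I V i x j))"
    using assms linear_maps_closed[OF direct_sum_incl_linear]
    by (intro direct_sum_lift_eq) (auto simp: direct_sum_incl_def)
  also have "\<dots> = g i x"
    using assms linear_maps_closed[OF g] by (simp add: direct_sum_incl_def)
  finally show ?thesis .
qed

end

end

lemma regular_module_simps [simp]:
  "carrier (regular_module K) = carrier K"
  "zero (regular_module K) = zero K"
  "add (regular_module K) = add K"
  "smult (regular_module K) = mult K"
  by (simp_all add: regular_module_def)

lemma regular_left_module:
  assumes "ring K" shows "left_module K (regular_module K)"
proof -
  interpret ring K by fact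
  have "abelian_group (regular_module K)"
    by (rule abelian_group_cong[OF abelian_group_axioms]) auto
  then show ?thesis
    unfolding left_module_def left_module_axioms_def
    using assms by (auto simp: l_distr r_distr m_assoc)
qed

context ring
begin

lemma module_family_regular: "module_family R Y (\<lambda>_. regular_module R)"
  by (intro module_family.intro module_family_axioms.intro ring_axioms regular_left_module)

lemma free_module_left_module: "left_module R (free_module R Y)"
  unfolding free_module_def by (rule module_family.direct_sum_left_module[OF module_family_regular])

lemma basis_elem_eq_incl: "basis_elem R Y y = direct_sum_incl Y (\<lambda>_. regular_module R) y \<one>\<^bsub>R\<^esub>"
  by (auto simp: basis_elem_def direct_sum_incl_def)

lemma basis_elem_closed: "y \<in> Y \<Longrightarrow> basis_elem R Y y \<in> carrier (free_module R Y)"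
  unfolding basis_elem_eq_incl free_module_def
  by (rule linear_maps_closed[OF module_family.direct_sum_incl_linear[OF module_family_regular]]) auto

lemma free_module_generated:
  assumes N: "submodule N R (free_module R Y)" and basis: "\<And>y. y \<in> Y \<Longrightarrow> basis_elem R Y y \<in> N"
  shows "N = carrier (free_module R Y)"
proof (rule subset_antisym[OF submodule_subset[OF N]])
  show "carrier (free_module R Y) \<subseteq> N"
    unfolding free_module_def
  proof (rule module_family.direct_sum_generated[OF module_family_regular])
    show "\<zero>\<^bsub>direct_sum Y (\<lambda>_. regular_module R)\<^esub> \<in> N"
      using submodule_zero[OF N] by (simp add: free_module_def)
    show "f \<oplus>\<^bsub>direct_sum Y (\<lambda>_. regular_module R)\<^esub> g \<in> N" if "f \<in> N" "g \<in> N" for f g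
      using submodule_add[OF N that] by (simp add: free_module_def)
    fix y x assume y: "y \<in> Y" and x: "x \<in> carrier (regular_module R)"
    have "x \<odot>\<^bsub>free_module R Y\<^esub> basis_elem R Y y \<in> N"
      using submodule_smult[OF N] x basis[OF y] by simp
    also have "x \<odot>\<^bsub>free_module R Y\<^esub> basis_elem R Y y = direct_sum_incl Y (\<lambda>_. regular_module R) y x"
      using x by (auto simp: free_module_def basis_elem_def direct_sum_incl_def)
    finally show "direct_sum_incl Y (\<lambda>_. regular_module R) y x \<in> N" .
  qed
qed

context
  fixes Y :: "'y set" and V :: "('a, 'n) module" and f :: "'y \<Rightarrow> 'n"
  assumes V: "left_module R V" and f: "\<And>y. y \<in> Y \<Longrightarrow> f y \<in> carrier V"
begin

interpretation V: left_module R V by (fact V)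

text \<open>
  A free module is a direct sum of copies of the ring, and linear extension is the map induced on
  this sum by the maps \<open>c \<mapsto> c f(y)\<close>.
\<close>

lemma linear_extension_eq_lift:
  "linear_extension R Y V f = direct_sum_lift Y (\<lambda>_. regular_module R) V (\<lambda>y c. c \<odot>\<^bsub>V\<^esub> f y)"
  by (simp add: linear_extension_def direct_sum_lift_def fun_eq_iff)

lemma scale_linear: "y \<in> Y \<Longrightarrow> (\<lambda>c. c \<odot>\<^bsub>V\<^esub> f y) \<in> linear_maps R (regular_module R) V"
  by (rule linear_mapsI) (auto simp: f V.lsmult_closed V.lsmult_l_distr V.lsmult_assoc)

lemma linear_extension_linear: "linear_extension R Y V f \<in> linear_maps R (free_module R Y) V"
  unfolding free_module_def linear_extension_eq_lift
  by (rule module_family.direct_sum_lift_linear[OF module_family_regular V scale_linear])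

lemma linear_extension_basis: 
  assumes "y \<in> Y"
  shows "linear_extension R Y V f (basis_elem R Y y) = f y"
  unfolding basis_elem_eq_incl linear_extension_eq_lift
  using assms by (subst module_family.direct_sum_lift_incl[OF module_family_regular V scale_linear])
    (auto simp: V.lsmult_one f)

end

end


section \<open>The tensor modules\<close>

text \<open>
  The relations for one entry are the defects of additivity and homogeneity in that entry. A linear
  map on the free module thus kills them if and only if its values on the basis are linear there.
\<close>

lemma slot_relations_iff:
  assumes K: "cring K" and V: "left_module K V" and W: "left_module K W" 
    and L: "L \<in> linear_maps K (free_module K T) W" 
    and c: "\<And>u. u \<in> carrier V \<Longrightarrow> c u \<in> T"
  shows "slot_relations K T V c \<subseteq> {x \<in> carrier (free_module K T). L x = \<zero>\<^bsub>W\<^esub>} \<longleftrightarrow>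
    (\<lambda>u. L (basis_elem K T (c u))) \<in> linear_maps K V W" (is "_ \<subseteq> ?N \<longleftrightarrow> _")
proof -
  interpret K: cring K by fact
  interpret V: left_module K V by fact
  interpret W: left_module K W by fact
  interpret F: left_module K "free_module K T" by (rule K.free_module_left_module)
  have b: "basis_elem K T (c u) \<in> carrier (free_module K T)" if "u \<in> carrier V" for u
    using c[OF that] by (rule K.basis_elem_closed)
  have Lb: "L (basis_elem K T (c u)) \<in> carrier W" if "u \<in> carrier V" for u
    using b[OF that] by (rule linear_maps_closed[OF L])
  have add: "basis_elem K T (c (u \<oplus>\<^bsub>V\<^esub> v)) \<ominus>\<^bsub>free_module K T\<^esub>
        (basis_elem K T (c u) \<oplus>\<^bsub>free_module K T\<^esub> basis_elem K T (c v)) \<in> ?N \<longleftrightarrow>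
      L (basis_elem K T (c (u \<oplus>\<^bsub>V\<^esub> v))) = L (basis_elem K T (c u)) \<oplus>\<^bsub>W\<^esub> L (basis_elem K T (c v))"
    if "u \<in> carrier V" "v \<in> carrier V" for u v
    using that by (simp add: b Lb linear_maps_minus[OF F.left_module_axioms W L]
        linear_maps_add[OF L] W.M.minus_eq_zero_iff)
  have smult: "basis_elem K T (c (a \<odot>\<^bsub>V\<^esub> u)) \<ominus>\<^bsub>free_module K T\<^esub>
        a \<odot>\<^bsub>free_module K T\<^esub> basis_elem K T (c u) \<in> ?N \<longleftrightarrow>
      L (basis_elem K T (c (a \<odot>\<^bsub>V\<^esub> u))) = a \<odot>\<^bsub>W\<^esub> L (basis_elem K T (c u))"
    if "a \<in> carrier K" "u \<in> carrier V" for a u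
    using that by (simp add: b Lb linear_maps_minus[OF F.left_module_axioms W L]
        linear_maps_smult[OF L] W.M.minus_eq_zero_iff V.lsmult_closed F.lsmult_closed W.lsmult_closed)
  have "slot_relations K T V c \<subseteq> ?N \<longleftrightarrow>
    (\<forall>u\<in>carrier V. \<forall>v\<in>carrier V. basis_elem K T (c (u \<oplus>\<^bsub>V\<^esub> v)) \<ominus>\<^bsub>free_module K T\<^esub>
        (basis_elem K T (c u) \<oplus>\<^bsub>free_module K T\<^esub> basis_elem K T (c v)) \<in> ?N) \<and>
    (\<forall>a\<in>carrier K. \<forall>u\<in>carrier V. basis_elem K T (c (a \<odot>\<^bsub>V\<^esub> u)) \<ominus>\<^bsub>free_module K T\<^esub>
        a \<odot>\<^bsub>free_module K T\<^esub> basis_elem K T (c u) \<in> ?N)"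
    unfolding slot_relations_def by blast
  also have "\<dots> \<longleftrightarrow> (\<lambda>u. L (basis_elem K T (c u))) \<in> linear_maps K V W"
    by (simp only: add smult cong: ball_cong) (auto simp: linear_maps_def Lb)
  finally show ?thesis .
qed

locale tensor_powers = unital_algebra K R
  for K :: "('k, 'p) ring_scheme" and R :: "('k, 'r, 'q) module_scheme" +
  fixes \<Omega> :: "'w set" and X :: "'x set"
begin

abbreviation "tuples \<equiv> tensor_tuples K R \<Omega> X"
abbreviation "tuple_module n \<equiv> free_module K (tuples n)"
abbreviation "factor_pairs \<equiv> carrier R \<times> carrier (free_module K \<Omega>)"
abbreviation "ker \<equiv> tensor_kernel K R \<Omega> X"
abbreviation "tensors \<equiv> tensor_module K R \<Omega> X"
abbreviation "pure \<equiv> pure_tensor K R \<Omega> X"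

lemma K_left_module_R: "left_module K R"
  using module_imp_left_module module_axioms .

lemma tuple_left_module: "left_module K (tuple_module n)"
  by (rule K.free_module_left_module)

lemma K\<Omega>_left_module: "left_module K (free_module K \<Omega>)"
  by (rule K.free_module_left_module)

lemma KX_left_module: "left_module K (free_module K X)"
  by (rule K.free_module_left_module)

text \<open>
  The four clauses follow the four families of relations: an algebra entry or an operator entry
  of a pair, the last algebra entry, and the generator entry.
\<close>

definition multilinear ::
    "nat \<Rightarrow> ('k, 'm) module \<Rightarrow> (('k, 'r, 'w, 'x) tuple \<Rightarrow> 'm) \<Rightarrow> bool"
  where "multilinear n W f \<longleftrightarrow>
    (\<forall>ps u qs r v. length ps + length qs + 2 = n \<and> set ps \<subseteq> factor_pairs \<and> set qs \<subseteq> factor_pairs \<and>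
        u \<in> carrier (free_module K \<Omega>) \<and> r \<in> carrier R \<and> v \<in> carrier (free_module K X) \<longrightarrow>
        (\<lambda>t. f (ps @ (t, u) # qs, r, v)) \<in> linear_maps K R W) \<and>
    (\<forall>ps s qs r v. length ps + length qs + 2 = n \<and> set ps \<subseteq> factor_pairs \<and> set qs \<subseteq> factor_pairs \<and>
        s \<in> carrier R \<and> r \<in> carrier R \<and> v \<in> carrier (free_module K X) \<longrightarrow>
        (\<lambda>t. f (ps @ (s, t) # qs, r, v)) \<in> linear_maps K (free_module K \<Omega>) W) \<and>
    (\<forall>ps v. length ps + 1 = n \<and> set ps \<subseteq> factor_pairs \<and> v \<in> carrier (free_module K X) \<longrightarrow>
        (\<lambda>t. f (ps, t, v)) \<in> linear_maps K R W) \<and>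
    (\<forall>ps r. length ps + 1 = n \<and> set ps \<subseteq> factor_pairs \<and> r \<in> carrier R \<longrightarrow>
        (\<lambda>t. f (ps, r, t)) \<in> linear_maps K (free_module K X) W)"

lemma tensor_relations_subset_iff:
  "tensor_relations K R \<Omega> X n \<subseteq> N \<longleftrightarrow>
    (\<forall>ps u qs r v. length ps + length qs + 2 = n \<and> set ps \<subseteq> factor_pairs \<and> set qs \<subseteq> factor_pairs \<and>
        u \<in> carrier (free_module K \<Omega>) \<and> r \<in> carrier R \<and> v \<in> carrier (free_module K X) \<longrightarrow>
        slot_relations K (tuples n) R (\<lambda>t. (ps @ (t, u) # qs, r, v)) \<subseteq> N) \<and>
    (\<forall>ps s qs r v. length ps + length qs + 2 = n \<and> set ps \<subseteq> factor_pairs \<and> set qs \<subseteq> factor_pairs \<and>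
        s \<in> carrier R \<and> r \<in> carrier R \<and> v \<in> carrier (free_module K X) \<longrightarrow>
        slot_relations K (tuples n) (free_module K \<Omega>) (\<lambda>t. (ps @ (s, t) # qs, r, v)) \<subseteq> N) \<and>
    (\<forall>ps v. length ps + 1 = n \<and> set ps \<subseteq> factor_pairs \<and> v \<in> carrier (free_module K X) \<longrightarrow>
        slot_relations K (tuples n) R (\<lambda>t. (ps, t, v)) \<subseteq> N) \<and>
    (\<forall>ps r. length ps + 1 = n \<and> set ps \<subseteq> factor_pairs \<and> r \<in> carrier R \<longrightarrow>
        slot_relations K (tuples n) (free_module K X) (\<lambda>t. (ps, r, t)) \<subseteq> N)"
  unfolding tensor_relations_def Let_def Un_subset_iff Sup_le_iff conj_assoc
  by (intro arg_cong2[where f = conj]; blast)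

lemma multilinear_closed:
  assumes "multilinear n W f" "t \<in> tuples n" shows "f t \<in> carrier W"
proof -
  obtain ps r v where "t = (ps, r, v)" "length ps + 1 = n" "set ps \<subseteq> factor_pairs"
    "r \<in> carrier R" "v \<in> carrier (free_module K X)"
    using assms(2) by (auto simp: tensor_tuples_def)
  then show ?thesis
    using assms(1) linear_maps_closed[of "\<lambda>t. f (ps, t, v)" K R W r]
    unfolding multilinear_def by blast
qed

lemma multilinear_cong:
  assumes "\<And>t. t \<in> tuples n \<Longrightarrow> f t = g t"
  shows "multilinear n W f \<longleftrightarrow> multilinear n W g"
  unfolding multilinear_def
  by (intro arg_cong2[where f = conj] iff_allI imp_cong refl
      linear_maps_cong[OF K_left_module_R] linear_maps_cong[OF K\<Omega>_left_module]
      linear_maps_cong[OF KX_left_module] assms)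
    (auto simp: tensor_tuples_def)

text \<open>
  With \<open>L\<close> the projection onto the tensor module this shows that pure tensors are multilinear, and
  with \<open>L\<close> a linear extension it shows that multilinear maps descend.
\<close>

lemma multilinear_iff_kills_relations:
  assumes W: "left_module K W" and L: "L \<in> linear_maps K (tuple_module n) W"
  shows "multilinear n W (\<lambda>t. L (basis_elem K (tuples n) t)) \<longleftrightarrow>
    tensor_relations K R \<Omega> X n \<subseteq> {x \<in> carrier (tuple_module n). L x = \<zero>\<^bsub>W\<^esub>}"
proof -
  note slot = slot_relations_iff[OF K.is_cring _ W L]
  note slots = slot[OF K_left_module_R] slot[OF K\<Omega>_left_module] slot[OF KX_left_module]
  show ?thesis
    unfolding multilinear_def tensor_relations_subset_iff
    by (intro arg_cong2[where f = conj] iff_allI imp_cong refl slots[symmetric])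
      (auto simp: tensor_tuples_def)
qed

lemma tensor_relations_closed: "tensor_relations K R \<Omega> X n \<subseteq> carrier (tuple_module n)"
proof -
  interpret F: left_module K "tuple_module n" by (rule tuple_left_module)
  have slot: "slot_relations K (tuples n) V c \<subseteq> carrier (tuple_module n)"
    if V: "left_module K V" and c: "\<And>u. u \<in> carrier V \<Longrightarrow> c u \<in> tuples n"
    for V :: "('k, 'v, 'z) module_scheme" and c
  proof -
    interpret V: left_module K V by (rule V)
    show ?thesis
      unfolding slot_relations_def
      by (auto intro!: F.M.minus_closed F.M.a_closed F.lsmult_closed K.basis_elem_closed
          c V.M.a_closed V.lsmult_closed)
  qed
  show ?thesis
    unfolding tensor_relations_subset_iff
    by (intro conjI allI impI slot K_left_module_R K\<Omega>_left_module KX_left_module)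
      (auto simp: tensor_tuples_def)
qed

lemma kernel_submodule: "submodule (ker n) K (tuple_module n)"
  unfolding tensor_kernel_def
  by (rule submodule_submodule_span[OF tuple_left_module tensor_relations_closed])

lemma tensors_left_module: "left_module K (tensors n)"
  unfolding tensor_module_def by (rule quotient_left_module[OF tuple_left_module kernel_submodule])

lemma tensors_coset_linear: "(\<lambda>x. ker n +>\<^bsub>tuple_module n\<^esub> x) \<in> linear_maps K (tuple_module n) (tensors n)"
  unfolding tensor_module_def by (rule coset_linear[OF tuple_left_module kernel_submodule])

lemma pure_multilinear: "multilinear n (tensors n) (pure n)"
proof -
  have "tensor_relations K R \<Omega> X n \<subseteq> ker n"
    unfolding tensor_kernel_def by (rule submodule_span_superset)
  then have "tensor_relations K R \<Omega> X n \<subseteq>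
    {x \<in> carrier (tuple_module n). ker n +>\<^bsub>tuple_module n\<^esub> x = \<zero>\<^bsub>tensors n\<^esub>}"
    using tensor_relations_closed coset_eq_zero[OF tuple_left_module kernel_submodule]
    by (auto simp: tensor_module_def)
  then show ?thesis
    unfolding multilinear_iff_kills_relations[OF tensors_left_module tensors_coset_linear, symmetric]
    by (simp add: pure_tensor_def[abs_def])
qed

lemma pure_closed: "t \<in> tuples n \<Longrightarrow> pure n t \<in> carrier (tensors n)"
  using pure_multilinear by (rule multilinear_closed)

text \<open>
  Pure tensors are the images of the basis of the free module on tuples.
\<close>

lemma tensors_generated:
  assumes N: "submodule N K (tensors n)" and pure: "\<And>t. t \<in> tuples n \<Longrightarrow> pure n t \<in> N"
  shows "N = carrier (tensors n)"
proof -
  have "{x \<in> carrier (tuple_module n). ker n +>\<^bsub>tuple_module n\<^esub> x \<in> N} = carrier (tuple_module n)"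
    by (rule K.free_module_generated[OF submodule_preimage[OF tuple_left_module tensors_left_module
            tensors_coset_linear N]])
      (use pure in \<open>auto simp: pure_tensor_def K.basis_elem_closed\<close>)
  then have "carrier (tensors n) \<subseteq> N"
    by (auto simp: tensor_module_def a_rcosets_eq_image)
  then show ?thesis using submodule_subset[OF N] by blast
qed

lemma tensors_linear_eqI:
  assumes "left_module K W" "f \<in> linear_maps K (tensors n) W" "g \<in> linear_maps K (tensors n) W"
    and "\<And>t. t \<in> tuples n \<Longrightarrow> f (pure n t) = g (pure n t)" and x: "x \<in> carrier (tensors n)"
  shows "f x = g x"
proof -
  have "{x \<in> carrier (tensors n). f x = g x} = carrier (tensors n)"
    by (rule tensors_generated[OF submodule_equalizer[OF tensors_left_module assms(1-3)]])
      (simp add: pure_closed assms(4))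
  then show ?thesis using x by blast
qed

lemma multilinear_extension_kills_kernel:
  assumes W: "left_module K W" and f: "multilinear n W f" and x: "x \<in> ker n"
  shows "linear_extension K (tuples n) W f x = \<zero>\<^bsub>W\<^esub>"
proof -
  have f_closed: "f t \<in> carrier W" if "t \<in> tuples n" for t
    using f that by (rule multilinear_closed)
  have L: "linear_extension K (tuples n) W f \<in> linear_maps K (tuple_module n) W"
    by (rule K.linear_extension_linear[OF W f_closed])
  have Lb: "linear_extension K (tuples n) W f (basis_elem K (tuples n) t) = f t" if "t \<in> tuples n" for t
    by (rule K.linear_extension_basis[OF W f_closed that])
  have "multilinear n W (\<lambda>t. linear_extension K (tuples n) W f (basis_elem K (tuples n) t))"
    using multilinear_cong[OF Lb] f by (rule iffD2)
  then have "ker n \<subseteq> {x \<in> carrier (tuple_module n). linear_extension K (tuples n) W f x = \<zero>\<^bsub>W\<^esub>}"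
    unfolding multilinear_iff_kills_relations[OF W L] tensor_kernel_def
    by (rule submodule_span_least[OF submodule_kernel[OF tuple_left_module W L]])
  then show ?thesis using x by auto
qed

text \<open>
  The universal property of the tensor product: the linear extension of a multilinear map to the
  free module on tuples vanishes on the relations and so descends to the quotient.
\<close>

lemma tensors_universal:
  assumes W: "left_module K W" and f: "multilinear n W f"
  obtains g where "g \<in> linear_maps K (tensors n) W"
    and "\<And>t. t \<in> tuples n \<Longrightarrow> g (pure n t) = f t"
proof -
  have f_closed: "f t \<in> carrier W" if "t \<in> tuples n" for t
    using f that by (rule multilinear_closed)
  have L: "linear_extension K (tuples n) W f \<in> linear_maps K (tuple_module n) W"
    by (rule K.linear_extension_linear[OF W f_closed])
  have Lb: "linear_extension K (tuples n) W f (basis_elem K (tuples n) t) = f t" if "t \<in> tuples n" for t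
    by (rule K.linear_extension_basis[OF W f_closed that])
  obtain g where g: "g \<in> linear_maps K (quotient_module (tuple_module n) (ker n)) W"
    "\<And>x. x \<in> carrier (tuple_module n) \<Longrightarrow>
      g (ker n +>\<^bsub>tuple_module n\<^esub> x) = linear_extension K (tuples n) W f x"
    using quotient_universal[OF tuple_left_module kernel_submodule W L
        multilinear_extension_kills_kernel[OF W f]] by blast
  show thesis
    by (rule that[of g])
      (use g in \<open>simp_all add: tensor_module_def pure_tensor_def K.basis_elem_closed Lb\<close>)
qed

text \<open>
  A map of tuples induces a map of tensor modules as soon as it is multilinear up to the relations
  of the target.
\<close>

lemma tensor_map_linear:
  assumes f: "\<And>t. t \<in> tuples n \<Longrightarrow> f t \<in> tuples n'"
    and multi: "multilinear n (tensors n') (\<lambda>t. pure n' (f t))"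
  shows "tensor_map K R \<Omega> X n n' f \<in> linear_maps K (tensors n) (tensors n')"
    and "\<And>t. t \<in> tuples n \<Longrightarrow> tensor_map K R \<Omega> X n n' f (pure n t) = pure n' (f t)"
proof -
  define b where "b t = basis_elem K (tuples n') (f t)" for t
  define l where "l = linear_extension K (tuples n) (tuple_module n') b"
  have b: "b t \<in> carrier (tuple_module n')" if "t \<in> tuples n" for t
    using f[OF that] by (simp add: b_def K.basis_elem_closed)
  have l: "l \<in> linear_maps K (tuple_module n) (tuple_module n')"
    unfolding l_def by (rule K.linear_extension_linear[OF tuple_left_module b])
  have lb: "l (basis_elem K (tuples n) t) = b t" if "t \<in> tuples n" for t
    unfolding l_def by (rule K.linear_extension_basis[OF tuple_left_module b that])
  have map: "tensor_map K R \<Omega> X n n' f = coset_map (tuple_module n') (ker n') l"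
    by (simp add: tensor_map_def Let_def l_def b_def[abs_def])
  let ?L = "linear_extension K (tuples n) (tensors n') (\<lambda>t. pure n' (f t))"
  have pf: "pure n' (f t) \<in> carrier (tensors n')" if "t \<in> tuples n" for t
    using f[OF that] by (rule pure_closed)
  have L: "?L \<in> linear_maps K (tuple_module n) (tensors n')"
    by (rule K.linear_extension_linear[OF tensors_left_module pf])
  have Lb: "?L (basis_elem K (tuples n) t) = pure n' (f t)" if "t \<in> tuples n" for t
    by (rule K.linear_extension_basis[OF tensors_left_module pf that])
  note pl = linear_maps_comp[OF l tensors_coset_linear]
  \<comment> \<open>The map on representatives followed by the projection is linear and has the prescribed values on the basis, so it is the linear extension, which kills the relations.\<close>
  have "{x \<in> carrier (tuple_module n). ker n' +>\<^bsub>tuple_module n'\<^esub> l x = ?L x} = carrier (tuple_module n)"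
    by (rule K.free_module_generated[OF submodule_equalizer[OF tuple_left_module tensors_left_module pl L]])
      (simp add: K.basis_elem_closed lb Lb, simp add: pure_tensor_def b_def)
  then have eq: "ker n' +>\<^bsub>tuple_module n'\<^esub> l x = ?L x" if "x \<in> carrier (tuple_module n)" for x
    using that by blast
  have "l x \<in> ker n'" if "x \<in> ker n" for x
  proof -
    have x: "x \<in> carrier (tuple_module n)" using that submodule_subset[OF kernel_submodule] by blast
    have "ker n' +>\<^bsub>tuple_module n'\<^esub> l x = \<zero>\<^bsub>tensors n'\<^esub>"
      using eq[OF x] multilinear_extension_kills_kernel[OF tensors_left_module multi that] by simp
    then show ?thesis
      using coset_eq_zero_iff[OF tuple_left_module kernel_submodule linear_maps_closed[OF l x]]
      by (simp add: tensor_module_def)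
  qed
  note coset = coset_map_linear[OF tuple_left_module tuple_left_module kernel_submodule
      kernel_submodule l this]
  show "tensor_map K R \<Omega> X n n' f \<in> linear_maps K (tensors n) (tensors n')"
    unfolding map using coset(1) by (simp add: tensor_module_def)
  show "tensor_map K R \<Omega> X n n' f (pure n t) = pure n' (f t)" if "t \<in> tuples n" for t
    unfolding map using coset(2) that by (simp add: pure_tensor_def K.basis_elem_closed lb b_def)
qed

end


section \<open>Restriction of scalars\<close>

lemma restrict_scalars_simps [simp]:
  "carrier (restrict_scalars A M) = carrier M"
  "zero (restrict_scalars A M) = zero M"
  "add (restrict_scalars A M) = add M"
  "smult (restrict_scalars A M) c x = (c \<odot>\<^bsub>A\<^esub> \<one>\<^bsub>A\<^esub>) \<odot>\<^bsub>M\<^esub> x"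
  by (simp_all add: restrict_scalars_def)

context unital_algebra
begin

lemma scalar_one_mult: "\<lbrakk>c \<in> carrier K; r \<in> carrier A\<rbrakk> \<Longrightarrow> (c \<odot>\<^bsub>A\<^esub> \<one>\<^bsub>A\<^esub>) \<otimes>\<^bsub>A\<^esub> r = c \<odot>\<^bsub>A\<^esub> r"
  by (simp add: smult_mult_left)

lemma mult_scalar_one: "\<lbrakk>c \<in> carrier K; r \<in> carrier A\<rbrakk> \<Longrightarrow> r \<otimes>\<^bsub>A\<^esub> (c \<odot>\<^bsub>A\<^esub> \<one>\<^bsub>A\<^esub>) = c \<odot>\<^bsub>A\<^esub> r"
  by (simp add: smult_mult_right)

lemma mult_left_linear: "r \<in> carrier A \<Longrightarrow> (\<lambda>s. r \<otimes>\<^bsub>A\<^esub> s) \<in> linear_maps K A A"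
  by (rule linear_mapsI) (simp_all add: A.r_distr smult_mult_right)

lemma mult_right_linear: "s \<in> carrier A \<Longrightarrow> (\<lambda>r. r \<otimes>\<^bsub>A\<^esub> s) \<in> linear_maps K A A"
  by (rule linear_mapsI) (simp_all add: A.l_distr smult_mult_left)

context
  fixes M :: "('a, 'm, 's) module_scheme"
  assumes M: "left_module A M"
begin

interpretation M: left_module A M by (fact M)

lemma restrict_scalars_left_module: "left_module K (restrict_scalars A M)"
proof -
  have "abelian_group (restrict_scalars A M)"
    by (rule abelian_group_cong[OF M.M.abelian_group_axioms]) simp_all
  then show ?thesis
    unfolding left_module_def left_module_axioms_def
    by (auto simp: K.ring_axioms M.lsmult_closed M.lsmult_r_distr smult_l_distr M.lsmult_l_distr
        M.lsmult_one M.lsmult_assoc[symmetric] scalar_one_mult smult_assoc1)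
qed

text \<open>
  The action of \<open>r\<close> is \<open>K\<close>-linear although it need not be linear over the algebra, because \<open>c 1\<close> is
  central.
\<close>

lemma act_linear:
  assumes "r \<in> carrier A"
  shows "(\<lambda>x. r \<odot>\<^bsub>M\<^esub> x) \<in> linear_maps K (restrict_scalars A M) (restrict_scalars A M)"
  by (rule linear_mapsI)
    (simp_all add: assms M.lsmult_closed M.lsmult_r_distr M.lsmult_assoc[symmetric]
      scalar_one_mult mult_scalar_one)

lemma orbit_linear:
  assumes "x \<in> carrier M"
  shows "(\<lambda>r. r \<odot>\<^bsub>M\<^esub> x) \<in> linear_maps K A (restrict_scalars A M)"
  by (rule linear_mapsI)
    (simp_all add: assms M.lsmult_closed M.lsmult_l_distr M.lsmult_assoc[symmetric] scalar_one_mult)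

lemma linear_maps_restrict:
  assumes "h \<in> linear_maps A M N"
  shows "h \<in> linear_maps K (restrict_scalars A M) (restrict_scalars A N)"
  by (rule linear_mapsI)
    (simp_all add: linear_maps_closed[OF assms] linear_maps_add[OF assms] linear_maps_smult[OF assms])

lemma submodule_restrict:
  assumes "submodule N A M"
  shows "submodule N K (restrict_scalars A M)"
  by (rule left_module.submodule_intro[OF restrict_scalars_left_module])
    (use submodule_subset[OF assms] in \<open>simp_all add: submodule_zero[OF assms] submodule_add[OF assms]
      submodule_smult[OF assms]\<close>)

end

end

section \<open>The action of the algebra on the tensor modules\<close>

context tensor_powers
begin

lemma multilinearI:
  assumes "\<And>ps u qs r v. \<lbrakk>length ps + length qs + 2 = n; set ps \<subseteq> factor_pairs; set qs \<subseteq> factor_pairs;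
        u \<in> carrier (free_module K \<Omega>); r \<in> carrier R; v \<in> carrier (free_module K X)\<rbrakk> \<Longrightarrow>
        (\<lambda>t. f (ps @ (t, u) # qs, r, v)) \<in> linear_maps K R W"
    and "\<And>ps s qs r v. \<lbrakk>length ps + length qs + 2 = n; set ps \<subseteq> factor_pairs; set qs \<subseteq> factor_pairs;
        s \<in> carrier R; r \<in> carrier R; v \<in> carrier (free_module K X)\<rbrakk> \<Longrightarrow>
        (\<lambda>t. f (ps @ (s, t) # qs, r, v)) \<in> linear_maps K (free_module K \<Omega>) W"
    and "\<And>ps v. \<lbrakk>length ps + 1 = n; set ps \<subseteq> factor_pairs; v \<in> carrier (free_module K X)\<rbrakk> \<Longrightarrow>
        (\<lambda>t. f (ps, t, v)) \<in> linear_maps K R W"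
    and "\<And>ps r. \<lbrakk>length ps + 1 = n; set ps \<subseteq> factor_pairs; r \<in> carrier R\<rbrakk> \<Longrightarrow>
        (\<lambda>t. f (ps, r, t)) \<in> linear_maps K (free_module K X) W"
  shows "multilinear n W f"
  unfolding multilinear_def by (intro conjI allI impI; elim conjE) (rule assms; assumption)+

lemma multilinear_algebra_slot:
  "\<lbrakk>multilinear n W f; length ps + length qs + 2 = n; set ps \<subseteq> factor_pairs; set qs \<subseteq> factor_pairs;
    u \<in> carrier (free_module K \<Omega>); r \<in> carrier R; v \<in> carrier (free_module K X)\<rbrakk> \<Longrightarrow>
   (\<lambda>t. f (ps @ (t, u) # qs, r, v)) \<in> linear_maps K R W"
  unfolding multilinear_def by blast

lemma multilinear_operator_slot:
  "\<lbrakk>multilinear n W f; length ps + length qs + 2 = n; set ps \<subseteq> factor_pairs; set qs \<subseteq> factor_pairs;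
    s \<in> carrier R; r \<in> carrier R; v \<in> carrier (free_module K X)\<rbrakk> \<Longrightarrow>
   (\<lambda>t. f (ps @ (s, t) # qs, r, v)) \<in> linear_maps K (free_module K \<Omega>) W"
  unfolding multilinear_def by blast

lemma multilinear_last_algebra_slot:
  "\<lbrakk>multilinear n W f; length ps + 1 = n; set ps \<subseteq> factor_pairs; v \<in> carrier (free_module K X)\<rbrakk> \<Longrightarrow>
   (\<lambda>t. f (ps, t, v)) \<in> linear_maps K R W"
  unfolding multilinear_def by blast

lemma multilinear_generator_slot:
  "\<lbrakk>multilinear n W f; length ps + 1 = n; set ps \<subseteq> factor_pairs; r \<in> carrier R\<rbrakk> \<Longrightarrow>
   (\<lambda>t. f (ps, r, t)) \<in> linear_maps K (free_module K X) W"
  unfolding multilinear_def by blast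

lemmas pure_slots =
  multilinear_algebra_slot[OF pure_multilinear] multilinear_operator_slot[OF pure_multilinear]
  multilinear_last_algebra_slot[OF pure_multilinear] multilinear_generator_slot[OF pure_multilinear]

lemma left_mult_tuple_closed:
  assumes "r \<in> carrier R" "t \<in> tuples n"
  shows "left_mult_tuple R r t \<in> tuples n"
  using assms by (cases "(R, r, t)" rule: left_mult_tuple.cases) (auto simp: tensor_tuples_def)

text \<open>
  Left multiplication changes the first algebra entry only. It is the last algebra entry when the
  list of pairs is empty and belongs to the first pair otherwise; hence the case distinctions.
\<close>

lemma left_mult_multilinear:
  assumes r: "r \<in> carrier R"
  shows "multilinear n (tensors n) (\<lambda>t. pure n (left_mult_tuple R r t))"
proof (rule multilinearI)
  fix ps u qs s v
  assume *: "length ps + length qs + 2 = n" "set ps \<subseteq> factor_pairs" "set qs \<subseteq> factor_pairs"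
    "u \<in> carrier (free_module K \<Omega>)" "s \<in> carrier R" "v \<in> carrier (free_module K X)"
  show "(\<lambda>t. pure n (left_mult_tuple R r (ps @ (t, u) # qs, s, v))) \<in> linear_maps K R (tensors n)"
  proof (cases ps)
    case Nil
    then show ?thesis
      using linear_maps_comp[OF mult_left_linear[OF r] pure_slots(1)[OF *]] by simp
  next
    case (Cons p ps')
    then obtain a b where p: "ps = (a, b) # ps'" by (cases p) auto
    then show ?thesis
      using pure_slots(1)[of "(r \<otimes>\<^bsub>R\<^esub> a, b) # ps'" qs n u s v] * r by simp
  qed
next
  fix ps a qs s v
  assume *: "length ps + length qs + 2 = n" "set ps \<subseteq> factor_pairs" "set qs \<subseteq> factor_pairs"
    "a \<in> carrier R" "s \<in> carrier R" "v \<in> carrier (free_module K X)"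
  show "(\<lambda>t. pure n (left_mult_tuple R r (ps @ (a, t) # qs, s, v)))
      \<in> linear_maps K (free_module K \<Omega>) (tensors n)"
  proof (cases ps)
    case Nil
    then show ?thesis using pure_slots(2)[of "[]" qs n "r \<otimes>\<^bsub>R\<^esub> a" s v] * r by simp
  next
    case (Cons p ps')
    then obtain c b where p: "ps = (c, b) # ps'" by (cases p) auto
    then show ?thesis
      using pure_slots(2)[of "(r \<otimes>\<^bsub>R\<^esub> c, b) # ps'" qs n a s v] * r by simp
  qed
next
  fix ps v
  assume *: "length ps + 1 = n" "set ps \<subseteq> factor_pairs" "v \<in> carrier (free_module K X)"
  show "(\<lambda>t. pure n (left_mult_tuple R r (ps, t, v))) \<in> linear_maps K R (tensors n)"
  proof (cases ps)
    case Nil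
    then show ?thesis
      using linear_maps_comp[OF mult_left_linear[OF r] pure_slots(3)[OF *]] by simp
  next
    case (Cons p ps')
    then obtain a b where p: "ps = (a, b) # ps'" by (cases p) auto
    then show ?thesis
      using pure_slots(3)[of "(r \<otimes>\<^bsub>R\<^esub> a, b) # ps'" n v] * r by simp
  qed
next
  fix ps s
  assume *: "length ps + 1 = n" "set ps \<subseteq> factor_pairs" "s \<in> carrier R"
  show "(\<lambda>t. pure n (left_mult_tuple R r (ps, s, t))) \<in> linear_maps K (free_module K X) (tensors n)"
  proof (cases ps)
    case Nil
    then show ?thesis using pure_slots(4)[of "[]" n "r \<otimes>\<^bsub>R\<^esub> s"] * r by simp
  next
    case (Cons p ps')
    then obtain a b where p: "ps = (a, b) # ps'" by (cases p) auto
    then show ?thesis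
      using pure_slots(4)[of "(r \<otimes>\<^bsub>R\<^esub> a, b) # ps'" n s] * r by simp
  qed
qed

lemma left_mult_orbit_linear:
  assumes "t \<in> tuples n"
  shows "(\<lambda>r. pure n (left_mult_tuple R r t)) \<in> linear_maps K R (tensors n)"
proof -
  obtain ps s v where t: "t = (ps, s, v)" by (cases t)
  have *: "length ps + 1 = n" "set ps \<subseteq> factor_pairs" "s \<in> carrier R" "v \<in> carrier (free_module K X)"
    using assms by (auto simp: t tensor_tuples_def)
  show ?thesis
  proof (cases ps)
    case Nil
    then show ?thesis
      using linear_maps_comp[OF mult_right_linear[of s] pure_slots(3)[of ps n v]] * t by simp
  next
    case (Cons p qs)
    then obtain a u where p: "ps = (a, u) # qs" by (cases p) auto
    then show ?thesis
      using linear_maps_comp[OF mult_right_linear[of a] pure_slots(1)[of "[]" qs n u s v]] * t by simp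
  qed
qed

lemma left_mult_tuple_assoc:
  assumes "a \<in> carrier R" "b \<in> carrier R" "t \<in> tuples n"
  shows "left_mult_tuple R (a \<otimes>\<^bsub>R\<^esub> b) t = left_mult_tuple R a (left_mult_tuple R b t)"
  using assms by (cases "(R, b, t)" rule: left_mult_tuple.cases) (auto simp: tensor_tuples_def A.m_assoc)

lemma left_mult_tuple_one:
  assumes "t \<in> tuples n"
  shows "left_mult_tuple R \<one>\<^bsub>R\<^esub> t = t"
  using assms by (cases "(R, \<one>\<^bsub>R\<^esub>, t)" rule: left_mult_tuple.cases) (auto simp: tensor_tuples_def)

abbreviation "graded n \<equiv> tensor_left_module K R \<Omega> X n"

lemma graded_simps [simp]:
  "carrier (graded n) = carrier (tensors n)"
  "zero (graded n) = zero (tensors n)"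
  "add (graded n) = add (tensors n)"
  "smult (graded n) r = tensor_map K R \<Omega> X n n (left_mult_tuple R r)"
  by (simp_all add: tensor_left_module_def Let_def)

lemma graded_act_linear:
  "r \<in> carrier R \<Longrightarrow> (\<lambda>x. r \<odot>\<^bsub>graded n\<^esub> x) \<in> linear_maps K (tensors n) (tensors n)"
  using tensor_map_linear(1)[OF left_mult_tuple_closed left_mult_multilinear] by simp

lemma graded_act_pure:
  "\<lbrakk>r \<in> carrier R; t \<in> tuples n\<rbrakk> \<Longrightarrow> r \<odot>\<^bsub>graded n\<^esub> pure n t = pure n (left_mult_tuple R r t)"
  using tensor_map_linear(2)[OF left_mult_tuple_closed left_mult_multilinear] by simp

lemma graded_act_closed:
  "\<lbrakk>r \<in> carrier R; x \<in> carrier (tensors n)\<rbrakk> \<Longrightarrow> r \<odot>\<^bsub>graded n\<^esub> x \<in> carrier (tensors n)"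
  using linear_maps_closed[OF graded_act_linear] .

text \<open>
  Distributivity over sums of scalars, associativity and the law for the unit equate two
  \<open>K\<close>-linear functions of the module element, so it is enough to check them on pure tensors, where
  they become identities between tuples or linearity in the first entry.
\<close>

lemma graded_left_module: "left_module R (graded n)"
proof -
  interpret T: left_module K "tensors n" by (rule tensors_left_module)
  have ag: "abelian_group (graded n)"
    by (rule abelian_group_cong[OF T.M.abelian_group_axioms]) simp_all
  note eqI = tensors_linear_eqI[OF tensors_left_module]
  show ?thesis
  proof (intro left_module.intro left_module_axioms.intro A.ring_axioms ag)
    fix a b x assume a: "a \<in> carrier R" and b: "b \<in> carrier R" and x: "x \<in> carrier (graded n)"
    have x': "x \<in> carrier (tensors n)" using x by simp
    have "(a \<oplus>\<^bsub>R\<^esub> b) \<odot>\<^bsub>graded n\<^esub> x = a \<odot>\<^bsub>graded n\<^esub> x \<oplus>\<^bsub>tensors n\<^esub> b \<odot>\<^bsub>graded n\<^esub> x"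
    proof (rule eqI[OF graded_act_linear linear_maps_sum[OF T.left_module_axioms T.left_module_axioms
              graded_act_linear graded_act_linear] _ x'])
      show "(a \<oplus>\<^bsub>R\<^esub> b) \<odot>\<^bsub>graded n\<^esub> pure n t
          = a \<odot>\<^bsub>graded n\<^esub> pure n t \<oplus>\<^bsub>tensors n\<^esub> b \<odot>\<^bsub>graded n\<^esub> pure n t" if "t \<in> tuples n" for t
        using linear_maps_add[OF left_mult_orbit_linear[OF that] a b]
        by (simp only: graded_act_pure that a b A.a_closed)
    qed (simp_all add: a b)
    then show "(a \<oplus>\<^bsub>R\<^esub> b) \<odot>\<^bsub>graded n\<^esub> x = a \<odot>\<^bsub>graded n\<^esub> x \<oplus>\<^bsub>graded n\<^esub> b \<odot>\<^bsub>graded n\<^esub> x"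
      by simp
    show "(a \<otimes>\<^bsub>R\<^esub> b) \<odot>\<^bsub>graded n\<^esub> x = a \<odot>\<^bsub>graded n\<^esub> (b \<odot>\<^bsub>graded n\<^esub> x)"
    proof (rule eqI[OF graded_act_linear linear_maps_comp[OF graded_act_linear graded_act_linear] _ x'])
      show "(a \<otimes>\<^bsub>R\<^esub> b) \<odot>\<^bsub>graded n\<^esub> pure n t = a \<odot>\<^bsub>graded n\<^esub> (b \<odot>\<^bsub>graded n\<^esub> pure n t)"
        if "t \<in> tuples n" for t
        using that a b
        by (simp only: graded_act_pure left_mult_tuple_closed left_mult_tuple_assoc A.m_closed)
    qed (simp_all add: a b)
  next
    fix a x y assume "a \<in> carrier R" "x \<in> carrier (graded n)" "y \<in> carrier (graded n)"
    then show "a \<odot>\<^bsub>graded n\<^esub> (x \<oplus>\<^bsub>graded n\<^esub> y) = a \<odot>\<^bsub>graded n\<^esub> x \<oplus>\<^bsub>graded n\<^esub> a \<odot>\<^bsub>graded n\<^esub> y"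
      using linear_maps_add[OF graded_act_linear] by simp
  next
    fix x assume "x \<in> carrier (graded n)"
    then have x': "x \<in> carrier (tensors n)" by simp
    show "\<one>\<^bsub>R\<^esub> \<odot>\<^bsub>graded n\<^esub> x = x"
    proof (rule eqI[OF graded_act_linear _ _ x'])
      show "(\<lambda>x. x) \<in> linear_maps K (tensors n) (tensors n)" by (rule linear_mapsI) auto
      show "\<one>\<^bsub>R\<^esub> \<odot>\<^bsub>graded n\<^esub> pure n t = pure n t" if "t \<in> tuples n" for t
        using that by (simp only: graded_act_pure A.one_closed left_mult_tuple_one)
    qed simp
  qed (use graded_act_closed in simp)
qed

text \<open>
  The given action of \<open>K\<close> on the tensor module and the one through \<open>c \<mapsto> c 1\<close> coincide, so a
  tensor module may be used as a module over \<open>K\<close> in either way.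
\<close>

lemma graded_restrict_smult:
  assumes c: "c \<in> carrier K" and x: "x \<in> carrier (tensors n)"
  shows "(c \<odot>\<^bsub>R\<^esub> \<one>\<^bsub>R\<^esub>) \<odot>\<^bsub>graded n\<^esub> x = c \<odot>\<^bsub>tensors n\<^esub> x"
proof (rule tensors_linear_eqI[OF tensors_left_module graded_act_linear _ _ x])
  show "(\<lambda>x. c \<odot>\<^bsub>tensors n\<^esub> x) \<in> linear_maps K (tensors n) (tensors n)"
    by (rule K.scalar_linear[OF tensors_left_module c])
  show "(c \<odot>\<^bsub>R\<^esub> \<one>\<^bsub>R\<^esub>) \<odot>\<^bsub>graded n\<^esub> pure n t = c \<odot>\<^bsub>tensors n\<^esub> pure n t" if t: "t \<in> tuples n" for t
    using linear_maps_smult[OF left_mult_orbit_linear[OF t] c A.one_closed] t c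
    by (simp only: graded_act_pure smult_closed A.one_closed left_mult_tuple_one)
qed (simp add: c)


section \<open>The module of all tensors\<close>

abbreviation "MR \<equiv> MR_module K R \<Omega> X"
abbreviation "incl \<equiv> direct_sum_incl {1..} (tensor_left_module K R \<Omega> X)"

lemma module_family_graded: "module_family R {1..} (tensor_left_module K R \<Omega> X)"
  by (intro module_family.intro module_family_axioms.intro A.ring_axioms graded_left_module)

lemma MR_left_module: "left_module R MR"
  unfolding MR_module_def by (rule module_family.direct_sum_left_module[OF module_family_graded])

lemma restricted_MR_left_module: "left_module K (restrict_scalars R MR)"
  by (rule restrict_scalars_left_module[OF MR_left_module])

lemma MR_component: "\<lbrakk>a \<in> carrier MR; 1 \<le> n\<rbrakk> \<Longrightarrow> a n \<in> carrier (tensors n)"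
  unfolding MR_module_def using direct_sum_component[of a "{1..}"] by fastforce

lemma MR_add: "1 \<le> n \<Longrightarrow> (a \<oplus>\<^bsub>MR\<^esub> b) n = a n \<oplus>\<^bsub>tensors n\<^esub> b n"
  and MR_smult: "1 \<le> n \<Longrightarrow> (r \<odot>\<^bsub>MR\<^esub> a) n = r \<odot>\<^bsub>graded n\<^esub> a n"
  by (simp_all add: MR_module_def)

lemma MR_eqI:
  assumes "a \<in> carrier MR" "b \<in> carrier MR" "a 1 = b 1"
    "\<And>n. 1 \<le> n \<Longrightarrow> a (Suc n) = b (Suc n)"
  shows "a = b"
  using assms(1,2) unfolding MR_module_def
proof (rule direct_sum_ext)
  fix n :: nat assume "n \<in> {1..}"
  then show "a n = b n" using assms(3,4) by (cases "n = 1"; cases n) auto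
qed

lemma incl_linear: "1 \<le> n \<Longrightarrow> incl n \<in> linear_maps R (graded n) MR"
  unfolding MR_module_def by (rule module_family.direct_sum_incl_linear[OF module_family_graded]) simp

lemma incl_K_linear:
  assumes "1 \<le> n"
  shows "incl n \<in> linear_maps K (tensors n) (restrict_scalars R MR)"
proof (rule linear_mapsI)
  note L = incl_linear[OF assms]
  show "incl n x \<in> carrier (restrict_scalars R MR)" if "x \<in> carrier (tensors n)" for x
    using linear_maps_closed[OF L] that by simp
  show "incl n (x \<oplus>\<^bsub>tensors n\<^esub> y) = incl n x \<oplus>\<^bsub>restrict_scalars R MR\<^esub> incl n y"
    if "x \<in> carrier (tensors n)" "y \<in> carrier (tensors n)" for x y
    using linear_maps_add[OF L] that by simp
  show "incl n (c \<odot>\<^bsub>tensors n\<^esub> x) = c \<odot>\<^bsub>restrict_scalars R MR\<^esub> incl n x"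
    if "c \<in> carrier K" "x \<in> carrier (tensors n)" for c x
    using linear_maps_smult[OF L, of "c \<odot>\<^bsub>R\<^esub> \<one>\<^bsub>R\<^esub>" x] graded_restrict_smult[OF that] that by simp
qed

lemma MR_generated_by_components:
  assumes "\<zero>\<^bsub>MR\<^esub> \<in> N" "\<And>a b. \<lbrakk>a \<in> N; b \<in> N\<rbrakk> \<Longrightarrow> a \<oplus>\<^bsub>MR\<^esub> b \<in> N"
    and "\<And>n x. \<lbrakk>1 \<le> n; x \<in> carrier (tensors n)\<rbrakk> \<Longrightarrow> incl n x \<in> N"
  shows "carrier MR \<subseteq> N"
  using assms unfolding MR_module_def
  by (intro module_family.direct_sum_generated[OF module_family_graded]) simp_all

definition prepend :: "'w \<Rightarrow> ('k, 'r, 'w, 'x) tuple \<Rightarrow> ('k, 'r, 'w, 'x) tuple"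
  where "prepend \<omega> = (\<lambda>(ps, s, v). ((\<one>\<^bsub>R\<^esub>, basis_elem K \<Omega> \<omega>) # ps, s, v))"

lemma prepend_closed: "\<lbrakk>\<omega> \<in> \<Omega>; t \<in> tuples n\<rbrakk> \<Longrightarrow> prepend \<omega> t \<in> tuples (Suc n)"
  by (auto simp: prepend_def tensor_tuples_def K.basis_elem_closed)

text \<open>
  Prepending \<open>(1, \<omega>)\<close> leaves the other entries in place, so each entry of a tuple becomes an entry of
  the longer tuple.
\<close>

lemma prepend_multilinear:
  assumes "\<omega> \<in> \<Omega>"
  shows "multilinear n (tensors (Suc n)) (\<lambda>t. pure (Suc n) (prepend \<omega> t))"
proof -
  let ?p = "(\<one>\<^bsub>R\<^esub>, basis_elem K \<Omega> \<omega>)"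
  have p: "?p \<in> factor_pairs" using K.basis_elem_closed[OF assms] by simp
  show ?thesis
    unfolding prepend_def
  proof (rule multilinearI)
    fix ps u qs r v
    assume "length ps + length qs + 2 = n" "set ps \<subseteq> factor_pairs" "set qs \<subseteq> factor_pairs"
      "u \<in> carrier (free_module K \<Omega>)" "r \<in> carrier R" "v \<in> carrier (free_module K X)"
    then show "(\<lambda>t. pure (Suc n) (case (ps @ (t, u) # qs, r, v) of (ps, s, v) \<Rightarrow> (?p # ps, s, v)))
        \<in> linear_maps K R (tensors (Suc n))"
      using pure_slots(1)[of "?p # ps" qs "Suc n" u r v] p by simp
  next
    fix ps s qs r v
    assume "length ps + length qs + 2 = n" "set ps \<subseteq> factor_pairs" "set qs \<subseteq> factor_pairs"
      "s \<in> carrier R" "r \<in> carrier R" "v \<in> carrier (free_module K X)"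
    then show "(\<lambda>t. pure (Suc n) (case (ps @ (s, t) # qs, r, v) of (ps, s, v) \<Rightarrow> (?p # ps, s, v)))
        \<in> linear_maps K (free_module K \<Omega>) (tensors (Suc n))"
      using pure_slots(2)[of "?p # ps" qs "Suc n" s r v] p by simp
  next
    fix ps v
    assume "length ps + 1 = n" "set ps \<subseteq> factor_pairs" "v \<in> carrier (free_module K X)"
    then show "(\<lambda>t. pure (Suc n) (case (ps, t, v) of (ps, s, v) \<Rightarrow> (?p # ps, s, v)))
        \<in> linear_maps K R (tensors (Suc n))"
      using pure_slots(3)[of "?p # ps" "Suc n" v] p by simp
  next
    fix ps r
    assume "length ps + 1 = n" "set ps \<subseteq> factor_pairs" "r \<in> carrier R"
    then show "(\<lambda>t. pure (Suc n) (case (ps, r, t) of (ps, s, v) \<Rightarrow> (?p # ps, s, v)))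
        \<in> linear_maps K (free_module K X) (tensors (Suc n))"
      using pure_slots(4)[of "?p # ps" "Suc n" r] p by simp
  qed
qed

definition raise :: "'w \<Rightarrow> nat \<Rightarrow> (('k, 'r, 'w, 'x) tuple \<Rightarrow> 'k) set \<Rightarrow> (('k, 'r, 'w, 'x) tuple \<Rightarrow> 'k) set"
  where "raise \<omega> n = tensor_map K R \<Omega> X n (Suc n) (prepend \<omega>)"

context
  fixes \<omega> assumes \<omega>: "\<omega> \<in> \<Omega>"
begin

lemma raise_linear: "raise \<omega> n \<in> linear_maps K (tensors n) (tensors (Suc n))"
  unfolding raise_def by (rule tensor_map_linear(1)[OF prepend_closed[OF \<omega>] prepend_multilinear[OF \<omega>]])

lemma raise_pure: "t \<in> tuples n \<Longrightarrow> raise \<omega> n (pure n t) = pure (Suc n) (prepend \<omega> t)"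
  unfolding raise_def by (rule tensor_map_linear(2)[OF prepend_closed[OF \<omega>] prepend_multilinear[OF \<omega>]])

lemma MR_op_components:
  "MR_op K R \<Omega> X \<omega> a = (\<lambda>n\<in>{1..}. if n = 1 then \<zero>\<^bsub>tensors n\<^esub> else raise \<omega> (n - 1) (a (n - 1)))"
  unfolding MR_op_def raise_def prepend_def by (intro restrict_ext) auto

lemma raise_zero: "raise \<omega> n \<zero>\<^bsub>tensors n\<^esub> = \<zero>\<^bsub>tensors (Suc n)\<^esub>"
  by (rule linear_maps_zero[OF tensors_left_module tensors_left_module raise_linear])

lemma tensors_zero_closed: "\<zero>\<^bsub>tensors n\<^esub> \<in> carrier (tensors n)"
proof -
  interpret left_module K "tensors n" by (rule tensors_left_module)
  show ?thesis by (rule M.zero_closed)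
qed

lemma MR_op_closed:
  assumes a: "a \<in> carrier MR"
  shows "MR_op K R \<Omega> X \<omega> a \<in> carrier MR"
  unfolding MR_op_components MR_module_def
proof (rule module_family.direct_sum_closedI[OF module_family_graded])
  fix n :: nat assume n: "n \<in> {1..}"
  show "(if n = 1 then \<zero>\<^bsub>tensors n\<^esub> else raise \<omega> (n - 1) (a (n - 1))) \<in> carrier (graded n)"
  proof (cases "n = 1")
    case False
    then have "raise \<omega> (n - 1) (a (n - 1)) \<in> carrier (tensors (Suc (n - 1)))"
      using n by (intro linear_maps_closed[OF raise_linear MR_component[OF a]]) auto
    with False n show ?thesis by simp
  qed (simp add: tensors_zero_closed)
next
  show "finite (Suc ` {n \<in> {1..}. a n \<noteq> \<zero>\<^bsub>graded n\<^esub>})"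
    using a unfolding MR_module_def by (intro finite_imageI direct_sum_finite_support)
next
  fix n :: nat assume n: "n \<in> {1..} - Suc ` {n \<in> {1..}. a n \<noteq> \<zero>\<^bsub>graded n\<^esub>}"
  show "(if n = 1 then \<zero>\<^bsub>tensors n\<^esub> else raise \<omega> (n - 1) (a (n - 1))) = \<zero>\<^bsub>graded n\<^esub>"
  proof (cases "n = 1")
    case False
    then obtain k where k: "n = Suc k" "1 \<le> k" using n by (cases n) auto
    then have "a k = \<zero>\<^bsub>tensors k\<^esub>" using n by auto
    with k show ?thesis using raise_zero by simp
  qed simp
qed

lemma MR_op_one: "MR_op K R \<Omega> X \<omega> a 1 = \<zero>\<^bsub>tensors 1\<^esub>"
  and MR_op_Suc: "1 \<le> n \<Longrightarrow> MR_op K R \<Omega> X \<omega> a (Suc n) = raise \<omega> n (a n)"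
  by (simp_all add: MR_op_components)

text \<open>
  The linearity is over \<open>K\<close> and not over the algebra: \<open>1 \<otimes> \<omega> \<otimes> r a\<close> and \<open>r \<otimes> \<omega> \<otimes> a\<close> are
  different tensors in general. It holds degree by degree.
\<close>

lemma MR_op_linear:
  "MR_op K R \<Omega> X \<omega> \<in> linear_maps K (restrict_scalars R MR) (restrict_scalars R MR)"
proof (rule linear_mapsI)
  interpret MR: left_module K "restrict_scalars R MR" by (rule restricted_MR_left_module)
  fix a b assume "a \<in> carrier (restrict_scalars R MR)" "b \<in> carrier (restrict_scalars R MR)"
  then have a: "a \<in> carrier MR" and b: "b \<in> carrier MR" by simp_all
  note op = MR_op_closed[OF a] MR_op_closed[OF b]
  have ab: "a \<oplus>\<^bsub>MR\<^esub> b \<in> carrier MR" using MR.M.a_closed[of a b] a b by simp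
  have op_ab: "MR_op K R \<Omega> X \<omega> a \<oplus>\<^bsub>MR\<^esub> MR_op K R \<Omega> X \<omega> b \<in> carrier MR"
    using MR.M.a_closed[of "MR_op K R \<Omega> X \<omega> a" "MR_op K R \<Omega> X \<omega> b"] op by simp
  have "MR_op K R \<Omega> X \<omega> (a \<oplus>\<^bsub>MR\<^esub> b) = MR_op K R \<Omega> X \<omega> a \<oplus>\<^bsub>MR\<^esub> MR_op K R \<Omega> X \<omega> b"
  proof (rule MR_eqI[OF MR_op_closed[OF ab] op_ab])
    interpret T: left_module K "tensors 1" by (rule tensors_left_module)
    show "MR_op K R \<Omega> X \<omega> (a \<oplus>\<^bsub>MR\<^esub> b) 1 = (MR_op K R \<Omega> X \<omega> a \<oplus>\<^bsub>MR\<^esub> MR_op K R \<Omega> X \<omega> b) 1"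
      by (simp only: MR_op_one MR_add order_refl T.M.zero_closed T.M.r_zero)
    show "MR_op K R \<Omega> X \<omega> (a \<oplus>\<^bsub>MR\<^esub> b) (Suc n)
        = (MR_op K R \<Omega> X \<omega> a \<oplus>\<^bsub>MR\<^esub> MR_op K R \<Omega> X \<omega> b) (Suc n)" if "1 \<le> n" for n
      using that MR_component[OF a that] MR_component[OF b that]
      by (simp add: MR_op_Suc MR_add linear_maps_add[OF raise_linear])
  qed
  then show "MR_op K R \<Omega> X \<omega> (a \<oplus>\<^bsub>restrict_scalars R MR\<^esub> b)
      = MR_op K R \<Omega> X \<omega> a \<oplus>\<^bsub>restrict_scalars R MR\<^esub> MR_op K R \<Omega> X \<omega> b" by simp
next
  interpret MR: left_module K "restrict_scalars R MR" by (rule restricted_MR_left_module)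
  fix c a assume c: "c \<in> carrier K" and "a \<in> carrier (restrict_scalars R MR)"
  then have a: "a \<in> carrier MR" by simp
  have closed: "c \<odot>\<^bsub>restrict_scalars R MR\<^esub> b \<in> carrier MR" if "b \<in> carrier MR" for b
    using MR.lsmult_closed[OF c, of b] that by simp
  have at: "(c \<odot>\<^bsub>restrict_scalars R MR\<^esub> b) n = c \<odot>\<^bsub>tensors n\<^esub> b n" if "b \<in> carrier MR" "1 \<le> n" for b n
    using graded_restrict_smult[OF c MR_component[OF that]] that(2)
    by (simp add: MR_smult del: graded_simps(4))
  show "MR_op K R \<Omega> X \<omega> (c \<odot>\<^bsub>restrict_scalars R MR\<^esub> a)
      = c \<odot>\<^bsub>restrict_scalars R MR\<^esub> MR_op K R \<Omega> X \<omega> a"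
  proof (rule MR_eqI[OF MR_op_closed[OF closed[OF a]] closed[OF MR_op_closed[OF a]]])
    interpret T: left_module K "tensors 1" by (rule tensors_left_module)
    show "MR_op K R \<Omega> X \<omega> (c \<odot>\<^bsub>restrict_scalars R MR\<^esub> a) 1
        = (c \<odot>\<^bsub>restrict_scalars R MR\<^esub> MR_op K R \<Omega> X \<omega> a) 1"
      by (simp only: MR_op_one at[OF MR_op_closed[OF a]] order_refl T.lsmult_r_null[OF c])
    show "MR_op K R \<Omega> X \<omega> (c \<odot>\<^bsub>restrict_scalars R MR\<^esub> a) (Suc n)
        = (c \<odot>\<^bsub>restrict_scalars R MR\<^esub> MR_op K R \<Omega> X \<omega> a) (Suc n)" if n: "1 \<le> n" for n
      by (simp only: at[OF MR_op_closed[OF a]] at[OF a n] MR_op_Suc[OF n] le_SucI[OF n]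
          linear_maps_smult[OF raise_linear c MR_component[OF a n]])
  qed
qed (simp add: MR_op_closed)

lemma MR_op_incl:
  assumes "1 \<le> n" "x \<in> carrier (tensors n)"
  shows "MR_op K R \<Omega> X \<omega> (incl n x) = incl (Suc n) (raise \<omega> n x)"
  unfolding MR_op_components direct_sum_incl_def
  using assms raise_zero by (intro restrict_ext) (auto simp: le_Suc_eq)

end

lemma MR_incl_eq: "MR_incl K R \<Omega> X x = incl 1 (pure 1 ([], \<one>\<^bsub>R\<^esub>, basis_elem K X x))"
  unfolding MR_incl_def direct_sum_incl_def by (rule restrict_ext) simp

lemma MR_incl_closed: "x \<in> X \<Longrightarrow> MR_incl K R \<Omega> X x \<in> carrier MR"
  unfolding MR_incl_eq
  using linear_maps_closed[OF incl_linear[of 1], of "pure 1 ([], \<one>\<^bsub>R\<^esub>, basis_elem K X x)"]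
  by (simp add: pure_closed tensor_tuples_def K.basis_elem_closed)

text \<open>
  A pure tensor arises from \<open>1 \<otimes> x\<close> by finitely many operators and actions:
  \<open>r \<otimes> \<omega> \<otimes> a\<close> is \<open>r\<close> times the value of the operator at \<open>a\<close>. General elements of \<open>K\<Omega>\<close> and
  \<open>KX\<close> are reached by linearity. This gives an induction on the number of pairs.
\<close>

lemma MR_generated:
  assumes N: "submodule N R MR"
    and op: "\<And>\<omega> a. \<lbrakk>\<omega> \<in> \<Omega>; a \<in> N\<rbrakk> \<Longrightarrow> MR_op K R \<Omega> X \<omega> a \<in> N"
    and gen: "\<And>x. x \<in> X \<Longrightarrow> MR_incl K R \<Omega> X x \<in> N"
  shows "N = carrier MR"
proof (rule subset_antisym[OF submodule_subset[OF N]])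
  have NK: "submodule N K (restrict_scalars R MR)"
    by (rule submodule_restrict[OF MR_left_module N])
  have act: "incl n (pure n (left_mult_tuple R r t)) \<in> N"
    if "1 \<le> n" "r \<in> carrier R" "t \<in> tuples n" "incl n (pure n t) \<in> N" for n r t
    using submodule_smult[OF N that(2,4)] linear_maps_smult[OF incl_linear[OF that(1)] that(2), of "pure n t"]
      graded_act_pure[OF that(2,3)] pure_closed[OF that(3)] by simp
  have pure: "incl n (pure n (ps, s, v)) \<in> N" if "(ps, s, v) \<in> tuples n" for ps n s v
    using that
  proof (induction ps arbitrary: n)
    case Nil
    then have n: "n = 1" and s: "s \<in> carrier R" and v: "v \<in> carrier (free_module K X)"
      by (auto simp: tensor_tuples_def)
    have lin: "(\<lambda>v. incl 1 (pure 1 ([], \<one>\<^bsub>R\<^esub>, v))) \<in> linear_maps K (free_module K X) (restrict_scalars R MR)"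
      by (rule linear_maps_comp[OF pure_slots(4) incl_K_linear]) auto
    have "{v \<in> carrier (free_module K X). incl 1 (pure 1 ([], \<one>\<^bsub>R\<^esub>, v)) \<in> N} = carrier (free_module K X)"
      by (rule K.free_module_generated[OF submodule_preimage[OF KX_left_module
              restricted_MR_left_module lin NK]])
        (simp add: K.basis_elem_closed gen[unfolded MR_incl_eq, simplified])
    then have "incl 1 (pure 1 ([], \<one>\<^bsub>R\<^esub>, v)) \<in> N" using v by blast
    then show ?case
      using act[of 1 s "([], \<one>\<^bsub>R\<^esub>, v)"] s v n by (simp add: tensor_tuples_def)
  next
    case (Cons p ps)
    obtain r u where p: "p = (r, u)" by (cases p)
    obtain m where n: "n = Suc m" and t: "(ps, s, v) \<in> tuples m" and m: "1 \<le> m"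
      using Cons.prems by (cases n) (auto simp: tensor_tuples_def)
    have r: "r \<in> carrier R" and u: "u \<in> carrier (free_module K \<Omega>)" and ps: "length ps + 1 = m"
      "set ps \<subseteq> factor_pairs" "s \<in> carrier R" "v \<in> carrier (free_module K X)"
      using Cons.prems by (auto simp: p n tensor_tuples_def)
    have lin: "(\<lambda>u. incl n (pure n ((\<one>\<^bsub>R\<^esub>, u) # ps, s, v)))
        \<in> linear_maps K (free_module K \<Omega>) (restrict_scalars R MR)"
      using linear_maps_comp[OF pure_slots(2)[of "[]" ps n "\<one>\<^bsub>R\<^esub>" s v] incl_K_linear[of n]] ps n by simp
    have basis: "incl n (pure n ((\<one>\<^bsub>R\<^esub>, basis_elem K \<Omega> \<omega>) # ps, s, v)) \<in> N" if \<omega>: "\<omega> \<in> \<Omega>" for \<omega>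
      using op[OF \<omega> Cons.IH[OF t]] MR_op_incl[OF \<omega> m pure_closed[OF t]] raise_pure[OF \<omega> t]
      by (simp add: prepend_def n)
    have "{u \<in> carrier (free_module K \<Omega>). incl n (pure n ((\<one>\<^bsub>R\<^esub>, u) # ps, s, v)) \<in> N}
        = carrier (free_module K \<Omega>)"
      by (rule K.free_module_generated[OF submodule_preimage[OF K\<Omega>_left_module
              restricted_MR_left_module lin NK]])
        (simp add: K.basis_elem_closed basis del: One_nat_def)
    then have "incl n (pure n ((\<one>\<^bsub>R\<^esub>, u) # ps, s, v)) \<in> N" using u by blast
    then show ?case
      using act[of n r "((\<one>\<^bsub>R\<^esub>, u) # ps, s, v)"] r u ps n p by (simp add: tensor_tuples_def)
  qed
  have "incl n x \<in> N" if n: "1 \<le> n" and x: "x \<in> carrier (tensors n)" for n x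
  proof -
    have "{x \<in> carrier (tensors n). incl n x \<in> N} = carrier (tensors n)"
    proof (rule tensors_generated[OF submodule_preimage[OF tensors_left_module
              restricted_MR_left_module incl_K_linear[OF n] NK]])
      fix t assume t: "t \<in> tuples n"
      then show "pure n t \<in> {x \<in> carrier (tensors n). incl n x \<in> N}"
        using pure[of "fst t" "fst (snd t)" "snd (snd t)" n] pure_closed[OF t] by simp
    qed
    then show ?thesis using x by blast
  qed
  then show "carrier MR \<subseteq> N"
    by (intro MR_generated_by_components submodule_zero[OF N] submodule_add[OF N])
qed

end


section \<open>Evaluation of tensors in a Rota-Baxter module\<close>

text \<open>
  The value \<open>r\<^sub>1 op(u\<^sub>1, r\<^sub>2 op(u\<^sub>2, \<dots> r\<^sub>n b(v)))\<close>. As a fold over the list of pairs it splits at any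
  entry into an inner value and a linear map applied to it.
\<close>

definition tuple_eval ::
  "('r, 'm) module \<Rightarrow> (('w \<Rightarrow> 'k) \<Rightarrow> 'm \<Rightarrow> 'm) \<Rightarrow> (('x \<Rightarrow> 'k) \<Rightarrow> 'm) \<Rightarrow> ('k, 'r, 'w, 'x) tuple \<Rightarrow> 'm"
  where "tuple_eval M op b = (\<lambda>(ps, s, v). foldr (\<lambda>(r, u) y. r \<odot>\<^bsub>M\<^esub> op u y) ps (s \<odot>\<^bsub>M\<^esub> b v))"

text \<open>
  Tensors can be evaluated in every left module with \<open>K\<close>-linear operators; the Rota-Baxter identity
  enters when the evaluation is passed to the quotient.
\<close>

locale RB_evaluation = tensor_powers K R \<Omega> X + left_module R M
  for K :: "('k, 'p) ring_scheme" and R :: "('k, 'r, 'q) module_scheme"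
    and \<Omega> :: "'w set" and X :: "'x set" and M :: "('r, 'm) module" +
  fixes m :: "'w \<Rightarrow> 'm \<Rightarrow> 'm" and \<phi> :: "'x \<Rightarrow> 'm"
  assumes m_linear:
      "\<omega> \<in> \<Omega> \<Longrightarrow> m \<omega> \<in> linear_maps K (restrict_scalars R M) (restrict_scalars R M)"
    and \<phi>_closed: "x \<in> X \<Longrightarrow> \<phi> x \<in> carrier M"
begin

abbreviation "MK \<equiv> restrict_scalars R M"

lemma MK_left_module: "left_module K MK"
  by (rule restrict_scalars_left_module[OF left_module_axioms])

text \<open>
  The entries of a tuple are elements of \<open>K\<Omega>\<close> and \<open>KX\<close>, so the operators and the values of the
  generators are first extended linearly.
\<close>

definition op :: "('w \<Rightarrow> 'k) \<Rightarrow> 'm \<Rightarrow> 'm"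
  where "op u y = linear_extension K \<Omega> MK (\<lambda>\<omega>. m \<omega> y) u"

definition gen :: "('x \<Rightarrow> 'k) \<Rightarrow> 'm"
  where "gen = linear_extension K X MK \<phi>"

abbreviation "ev \<equiv> tuple_eval M op gen"

lemma m_closed: "\<lbrakk>\<omega> \<in> \<Omega>; y \<in> carrier M\<rbrakk> \<Longrightarrow> m \<omega> y \<in> carrier M"
  using linear_maps_closed[OF m_linear] by simp

lemma op_linear_left: "y \<in> carrier M \<Longrightarrow> (\<lambda>u. op u y) \<in> linear_maps K (free_module K \<Omega>) MK"
  unfolding op_def by (rule K.linear_extension_linear[OF MK_left_module]) (simp add: m_closed)

lemma op_linear_right:
  assumes "u \<in> carrier (free_module K \<Omega>)"
  shows "op u \<in> linear_maps K MK MK"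
proof -
  have "(\<lambda>y. op u y) \<in> linear_maps K MK MK"
    unfolding op_def linear_extension_def
  proof (rule linear_maps_finsum[OF K.is_cring MK_left_module MK_left_module])
    fix \<omega> assume "\<omega> \<in> {\<omega> \<in> \<Omega>. u \<omega> \<noteq> \<zero>\<^bsub>K\<^esub>}"
    then show "u \<omega> \<in> carrier K" "(\<lambda>y. m \<omega> y) \<in> linear_maps K MK MK"
      using assms direct_sum_component[of u \<Omega> "\<lambda>_. regular_module K"]
      by (auto simp: free_module_def m_linear)
  qed
  then show ?thesis .
qed

lemma op_basis: "\<lbrakk>\<omega> \<in> \<Omega>; y \<in> carrier M\<rbrakk> \<Longrightarrow> op (basis_elem K \<Omega> \<omega>) y = m \<omega> y"
  unfolding op_def by (rule K.linear_extension_basis[OF MK_left_module]) (simp_all add: m_closed)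

lemma gen_linear: "gen \<in> linear_maps K (free_module K X) MK"
  unfolding gen_def by (rule K.linear_extension_linear[OF MK_left_module]) (simp add: \<phi>_closed)

lemma gen_basis: "x \<in> X \<Longrightarrow> gen (basis_elem K X x) = \<phi> x"
  unfolding gen_def by (rule K.linear_extension_basis[OF MK_left_module]) (simp_all add: \<phi>_closed)

lemma op_closed: "\<lbrakk>u \<in> carrier (free_module K \<Omega>); y \<in> carrier M\<rbrakk> \<Longrightarrow> op u y \<in> carrier M"
  using linear_maps_closed[OF op_linear_right] by simp

lemma gen_closed: "v \<in> carrier (free_module K X) \<Longrightarrow> gen v \<in> carrier M"
  using linear_maps_closed[OF gen_linear] by simp

lemma fold_linear:
  assumes "set ps \<subseteq> factor_pairs"
  shows "foldr (\<lambda>(r, u) y. r \<odot>\<^bsub>M\<^esub> op u y) ps \<in> linear_maps K MK MK"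
  using assms
proof (induction ps)
  case Nil
  show ?case by (rule linear_mapsI) auto
next
  case (Cons p ps)
  obtain r u where p: "p = (r, u)" by (cases p)
  have "(\<lambda>y. r \<odot>\<^bsub>M\<^esub> op u (foldr (\<lambda>(r, u) y. r \<odot>\<^bsub>M\<^esub> op u y) ps y)) \<in> linear_maps K MK MK"
    using Cons p by (intro linear_maps_comp[OF linear_maps_comp[OF Cons.IH op_linear_right]
          act_linear[OF left_module_axioms]]) auto
  then show ?case by (simp add: p comp_def)
qed

lemma fold_closed: "\<lbrakk>set ps \<subseteq> factor_pairs; y \<in> carrier M\<rbrakk> \<Longrightarrow>
  foldr (\<lambda>(r, u) y. r \<odot>\<^bsub>M\<^esub> op u y) ps y \<in> carrier M"
  using linear_maps_closed[OF fold_linear] by simp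

lemma ev_multilinear: "multilinear n MK ev"
proof (rule multilinearI)
  fix ps u qs r v
  assume *: "length ps + length qs + 2 = n" "set ps \<subseteq> factor_pairs" "set qs \<subseteq> factor_pairs"
    "u \<in> carrier (free_module K \<Omega>)" "r \<in> carrier R" "v \<in> carrier (free_module K X)"
  have "op u (foldr (\<lambda>(r, u) y. r \<odot>\<^bsub>M\<^esub> op u y) qs (r \<odot>\<^bsub>M\<^esub> gen v)) \<in> carrier M"
    using * by (intro op_closed fold_closed lsmult_closed gen_closed)
  from linear_maps_comp[OF orbit_linear[OF left_module_axioms this] fold_linear[OF *(2)]]
  show "(\<lambda>t. ev (ps @ (t, u) # qs, r, v)) \<in> linear_maps K R MK"
    by (simp add: tuple_eval_def)
next
  fix ps s qs r v
  assume *: "length ps + length qs + 2 = n" "set ps \<subseteq> factor_pairs" "set qs \<subseteq> factor_pairs"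
    "s \<in> carrier R" "r \<in> carrier R" "v \<in> carrier (free_module K X)"
  have "foldr (\<lambda>(r, u) y. r \<odot>\<^bsub>M\<^esub> op u y) qs (r \<odot>\<^bsub>M\<^esub> gen v) \<in> carrier M"
    using * by (intro fold_closed lsmult_closed gen_closed)
  from linear_maps_comp[OF linear_maps_comp[OF op_linear_left[OF this]
        act_linear[OF left_module_axioms *(4)]] fold_linear[OF *(2)]]
  show "(\<lambda>t. ev (ps @ (s, t) # qs, r, v)) \<in> linear_maps K (free_module K \<Omega>) MK"
    by (simp add: tuple_eval_def)
next
  fix ps v
  assume *: "length ps + 1 = n" "set ps \<subseteq> factor_pairs" "v \<in> carrier (free_module K X)"
  from linear_maps_comp[OF orbit_linear[OF left_module_axioms gen_closed[OF *(3)]] fold_linear[OF *(2)]]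
  show "(\<lambda>t. ev (ps, t, v)) \<in> linear_maps K R MK"
    by (simp add: tuple_eval_def)
next
  fix ps r
  assume *: "length ps + 1 = n" "set ps \<subseteq> factor_pairs" "r \<in> carrier R"
  from linear_maps_comp[OF linear_maps_comp[OF gen_linear act_linear[OF left_module_axioms *(3)]]
      fold_linear[OF *(2)]]
  show "(\<lambda>t. ev (ps, r, t)) \<in> linear_maps K (free_module K X) MK"
    by (simp add: tuple_eval_def)
qed

lemma ev_closed: "t \<in> tuples n \<Longrightarrow> ev t \<in> carrier M"
  using multilinear_closed[OF ev_multilinear] by simp

lemma ev_left_mult:
  assumes r: "r \<in> carrier R" and t: "t \<in> tuples n"
  shows "ev (left_mult_tuple R r t) = r \<odot>\<^bsub>M\<^esub> ev t"
proof -
  obtain ps s v where t': "t = (ps, s, v)" by (cases t)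
  have *: "set ps \<subseteq> factor_pairs" "s \<in> carrier R" "v \<in> carrier (free_module K X)"
    using t by (auto simp: t' tensor_tuples_def)
  show ?thesis
  proof (cases ps)
    case Nil
    then show ?thesis using r * by (simp add: t' tuple_eval_def lsmult_assoc gen_closed)
  next
    case (Cons p qs)
    then obtain a u where p: "ps = (a, u) # qs" by (cases p) auto
    then have "op u (foldr (\<lambda>(r, u) y. r \<odot>\<^bsub>M\<^esub> op u y) qs (s \<odot>\<^bsub>M\<^esub> gen v)) \<in> carrier M"
      using * by (intro op_closed fold_closed lsmult_closed gen_closed) auto
    then show ?thesis using r * p by (simp add: t' tuple_eval_def lsmult_assoc)
  qed
qed

lemma ev_prepend:
  assumes "\<omega> \<in> \<Omega>" "t \<in> tuples n"
  shows "ev (prepend \<omega> t) = m \<omega> (ev t)"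
  using assms ev_closed[OF assms(2)]
  by (auto simp: prepend_def tuple_eval_def op_basis lsmult_one m_closed split: prod.splits)

text \<open>
  On each degree the evaluation is determined by its values on pure tensors; linearity over \<open>R\<close> and
  compatibility with the operators reduce to \<open>ev_left_mult\<close> and \<open>ev_prepend\<close>.
\<close>

lemma evaluation_exists:
  obtains E where "E \<in> linear_maps R MR M"
    and "\<And>\<omega> a. \<lbrakk>\<omega> \<in> \<Omega>; a \<in> carrier MR\<rbrakk> \<Longrightarrow> E (MR_op K R \<Omega> X \<omega> a) = m \<omega> (E a)"
    and "\<And>x. x \<in> X \<Longrightarrow> E (MR_incl K R \<Omega> X x) = \<phi> x"
proof -
  have "\<forall>n. \<exists>g. g \<in> linear_maps K (tensors n) MK \<and> (\<forall>t\<in>tuples n. g (pure n t) = ev t)"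
    using tensors_universal[OF MK_left_module ev_multilinear] by metis
  then obtain G where G: "\<And>n. G n \<in> linear_maps K (tensors n) MK"
    and G_pure: "\<And>n t. t \<in> tuples n \<Longrightarrow> G n (pure n t) = ev t"
    by metis
  note eqI = tensors_linear_eqI[OF MK_left_module]
  have G_act: "G n (r \<odot>\<^bsub>graded n\<^esub> x) = r \<odot>\<^bsub>M\<^esub> G n x"
    if r: "r \<in> carrier R" and x: "x \<in> carrier (tensors n)" for n r x
  proof (rule eqI[OF linear_maps_comp[OF graded_act_linear[OF r] G]
        linear_maps_comp[OF G act_linear[OF left_module_axioms r]] _ x])
    show "G n (r \<odot>\<^bsub>graded n\<^esub> pure n t) = r \<odot>\<^bsub>M\<^esub> G n (pure n t)" if t: "t \<in> tuples n" for t
      by (simp only: graded_act_pure[OF r t] G_pure[OF t] G_pure[OF left_mult_tuple_closed[OF r t]]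
          ev_left_mult[OF r t])
  qed
  have G_R: "G n \<in> linear_maps R (graded n) M" for n
    using linear_maps_closed[OF G] linear_maps_add[OF G] G_act by (intro linear_mapsI) auto
  define E where "E = direct_sum_lift {1..} (tensor_left_module K R \<Omega> X) M G"
  have E: "E \<in> linear_maps R MR M"
    unfolding E_def MR_module_def
    by (rule module_family.direct_sum_lift_linear[OF module_family_graded left_module_axioms G_R])
  have E_incl: "E (incl n x) = G n x" if "1 \<le> n" "x \<in> carrier (tensors n)" for n x
    unfolding E_def using that
    by (intro module_family.direct_sum_lift_incl[OF module_family_graded left_module_axioms G_R]) auto
  have E_op: "E (MR_op K R \<Omega> X \<omega> a) = m \<omega> (E a)" if \<omega>: "\<omega> \<in> \<Omega>" and a: "a \<in> carrier MR" for \<omega> a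
  proof -
    let ?N = "{a \<in> carrier (restrict_scalars R MR). E (MR_op K R \<Omega> X \<omega> a) = m \<omega> (E a)}"
    have EK: "E \<in> linear_maps K (restrict_scalars R MR) MK"
      by (rule linear_maps_restrict[OF MR_left_module E])
    have N: "submodule ?N K (restrict_scalars R MR)"
      by (rule submodule_equalizer[OF restricted_MR_left_module MK_left_module
            linear_maps_comp[OF MR_op_linear[OF \<omega>] EK] linear_maps_comp[OF EK m_linear[OF \<omega>]]])
    have "carrier MR \<subseteq> ?N"
    proof (rule MR_generated_by_components)
      show "\<zero>\<^bsub>MR\<^esub> \<in> ?N" using submodule_zero[OF N] by simp
      show "a \<oplus>\<^bsub>MR\<^esub> b \<in> ?N" if "a \<in> ?N" "b \<in> ?N" for a b
        using submodule_add[OF N that] by simp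
      fix n x assume n: "1 \<le> n" and x: "x \<in> carrier (tensors n)"
      have "G (Suc n) (raise \<omega> n x) = m \<omega> (G n x)"
      proof (rule eqI[OF linear_maps_comp[OF raise_linear[OF \<omega>] G] linear_maps_comp[OF G m_linear[OF \<omega>]] _ x])
        show "G (Suc n) (raise \<omega> n (pure n t)) = m \<omega> (G n (pure n t))" if t: "t \<in> tuples n" for t
          by (simp only: raise_pure[OF \<omega> t] G_pure[OF t] G_pure[OF prepend_closed[OF \<omega> t]]
              ev_prepend[OF \<omega> t])
      qed
      then have "E (MR_op K R \<Omega> X \<omega> (incl n x)) = m \<omega> (E (incl n x))"
        using n by (simp only: MR_op_incl[OF \<omega> n x] E_incl[OF n x] le_SucI
            E_incl[of "Suc n", OF _ linear_maps_closed[OF raise_linear[OF \<omega>] x]])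
      then show "incl n x \<in> ?N"
        using linear_maps_closed[OF incl_linear[OF n]] x by simp
    qed
    then show ?thesis using a by blast
  qed
  have "E (MR_incl K R \<Omega> X x) = \<phi> x" if x: "x \<in> X" for x
  proof -
    have t: "([], \<one>\<^bsub>R\<^esub>, basis_elem K X x) \<in> tuples 1"
      by (simp add: tensor_tuples_def K.basis_elem_closed x)
    show ?thesis
      by (simp only: MR_incl_eq E_incl[OF order_refl pure_closed[OF t]] G_pure[OF t])
        (simp add: tuple_eval_def gen_basis x lsmult_one \<phi>_closed)
  qed
  then show thesis using that E E_op by blast
qed

end


section \<open>The quotient by the Rota-Baxter relations\<close>

locale RB_free_construction = multiple_RB_algebra K R \<Omega> lam P
  for K :: "('k, 'p) ring_scheme" and R :: "('k, 'r, 'q) module_scheme"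
    and \<Omega> :: "'w set" and lam and P +
  fixes X :: "'x set"
begin

sublocale tensor_powers K R \<Omega> X by unfold_locales

abbreviation "I \<equiv> RB_ideal K R \<Omega> lam P X"
abbreviation "F \<equiv> free_RB_module K R \<Omega> lam P X"
abbreviation "MRop \<equiv> MR_op K R \<Omega> X"

interpretation MR: left_module R MR by (rule MR_left_module)

lemma P_closed: "\<lbrakk>\<omega> \<in> \<Omega>; r \<in> carrier R\<rbrakk> \<Longrightarrow> P \<omega> r \<in> carrier R"
  using linear_maps_closed[OF P_linear] .

lemma weight_one_closed: "\<omega> \<in> \<Omega> \<Longrightarrow> lam \<omega> \<odot>\<^bsub>R\<^esub> \<one>\<^bsub>R\<^esub> \<in> carrier R"
  using weight_closed by simp

lemma RB_relations_closed: "RB_relations K R \<Omega> lam P X \<subseteq> carrier MR"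
  unfolding RB_relations_def Let_def
  by (auto intro!: MR.M.minus_closed MR.lsmult_closed MR_op_closed P_closed weight_one_closed)

text \<open>
  The intersection that defines the ideal is not empty, as it includes the whole module.
\<close>

lemma I_submodule: "submodule I R MR"
  unfolding RB_ideal_def
proof (rule MR.submodule_Inter)
  have "carrier MR \<in> {N. submodule N R MR \<and> (\<forall>\<omega>\<in>\<Omega>. MRop \<omega> ` N \<subseteq> N) \<and> RB_relations K R \<Omega> lam P X \<subseteq> N}"
    using MR.submodule_carrier RB_relations_closed MR_op_closed by auto
  then show "{N. submodule N R MR \<and> (\<forall>\<omega>\<in>\<Omega>. MRop \<omega> ` N \<subseteq> N) \<and> RB_relations K R \<Omega> lam P X \<subseteq> N} \<noteq> {}"
    by blast
qed blast

lemma I_stable: "\<lbrakk>\<omega> \<in> \<Omega>; a \<in> I\<rbrakk> \<Longrightarrow> MRop \<omega> a \<in> I"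
  and I_relations: "RB_relations K R \<Omega> lam P X \<subseteq> I"
  and I_least: "\<lbrakk>submodule N R MR; \<And>\<omega> a. \<lbrakk>\<omega> \<in> \<Omega>; a \<in> N\<rbrakk> \<Longrightarrow> MRop \<omega> a \<in> N;
    RB_relations K R \<Omega> lam P X \<subseteq> N\<rbrakk> \<Longrightarrow> I \<subseteq> N"
  unfolding RB_ideal_def by blast+

abbreviation "\<pi> a \<equiv> I +>\<^bsub>MR\<^esub> a"

lemma F_left_module: "left_module R F"
  unfolding free_RB_module_def by (rule quotient_left_module[OF MR_left_module I_submodule])

lemma \<pi>_linear: "(\<lambda>a. \<pi> a) \<in> linear_maps R MR F"
  unfolding free_RB_module_def by (rule coset_linear[OF MR_left_module I_submodule])

lemma carrier_F: "carrier F = (\<lambda>a. \<pi> a) ` carrier MR"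
  by (simp add: free_RB_module_def a_rcosets_eq_image)

lemma op_\<pi>:
  assumes "\<omega> \<in> \<Omega>" "a \<in> carrier MR"
  shows "free_RB_op K R \<Omega> lam P X \<omega> (\<pi> a) = \<pi> (MRop \<omega> a)"
  unfolding free_RB_op_def
proof (rule coset_map_coset)
  show "abelian_group_hom MR MR (MRop \<omega>)"
    using linear_maps_closed[OF MR_op_linear[OF assms(1)]] linear_maps_add[OF MR_op_linear[OF assms(1)]]
    by (intro abelian_group_hom_intro MR.M.abelian_group_axioms) auto
qed (use assms I_stable MR.submodule_imp_abelian_subgroup[OF I_submodule] in auto)

text \<open>
  The operators on the quotient inherit linearity from representatives. The module identity for
  a coset is the image of the corresponding relation, which lies in the ideal.
\<close>

lemma F_RB_module: "RB_module K R \<Omega> lam P F (free_RB_op K R \<Omega> lam P X)"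
proof -
  interpret F: left_module R F by (rule F_left_module)
  have \<pi>_closed: "\<pi> a \<in> carrier F" if "a \<in> carrier MR" for a
    using linear_maps_closed[OF \<pi>_linear that] .
  show ?thesis
  proof (intro RB_module.intro RB_module_axioms.intro multiple_RB_algebra_axioms F_left_module)
    fix \<omega> assume \<omega>: "\<omega> \<in> \<Omega>"
    note op_lin = MR_op_linear[OF \<omega>]
    have \<pi>K: "(\<lambda>a. \<pi> a) \<in> linear_maps K (restrict_scalars R MR) (restrict_scalars R F)"
      by (rule linear_maps_restrict[OF MR_left_module \<pi>_linear])
    note comp = linear_maps_comp[OF op_lin \<pi>K]
    show "free_RB_op K R \<Omega> lam P X \<omega> \<in> linear_maps K (restrict_scalars R F) (restrict_scalars R F)"
    proof (rule linear_mapsI)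
      fix x y assume "x \<in> carrier (restrict_scalars R F)" "y \<in> carrier (restrict_scalars R F)"
      then obtain a b where ab: "a \<in> carrier MR" "b \<in> carrier MR" "x = \<pi> a" "y = \<pi> b"
        by (auto simp: carrier_F)
      show "free_RB_op K R \<Omega> lam P X \<omega> x \<in> carrier (restrict_scalars R F)"
        using ab by (simp add: op_\<pi>[OF \<omega>] \<pi>_closed MR_op_closed[OF \<omega>])
      show "free_RB_op K R \<Omega> lam P X \<omega> (x \<oplus>\<^bsub>restrict_scalars R F\<^esub> y)
        = free_RB_op K R \<Omega> lam P X \<omega> x \<oplus>\<^bsub>restrict_scalars R F\<^esub> free_RB_op K R \<Omega> lam P X \<omega> y"
        using linear_maps_add[OF comp] linear_maps_add[OF \<pi>_linear ab(1,2), symmetric] ab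
        by (simp add: op_\<pi>[OF \<omega>])
    next
      fix c x assume c: "c \<in> carrier K" and "x \<in> carrier (restrict_scalars R F)"
      then obtain a where a: "a \<in> carrier MR" "x = \<pi> a" by (auto simp: carrier_F)
      have "(c \<odot>\<^bsub>R\<^esub> \<one>\<^bsub>R\<^esub>) \<odot>\<^bsub>F\<^esub> x = \<pi> ((c \<odot>\<^bsub>R\<^esub> \<one>\<^bsub>R\<^esub>) \<odot>\<^bsub>MR\<^esub> a)"
        using linear_maps_smult[OF \<pi>_linear, of "c \<odot>\<^bsub>R\<^esub> \<one>\<^bsub>R\<^esub>" a] a c by simp
      then show "free_RB_op K R \<Omega> lam P X \<omega> (c \<odot>\<^bsub>restrict_scalars R F\<^esub> x)
        = c \<odot>\<^bsub>restrict_scalars R F\<^esub> free_RB_op K R \<Omega> lam P X \<omega> x"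
        using linear_maps_smult[OF comp c, of a] a c
        by (simp add: op_\<pi>[OF \<omega>] MR.lsmult_closed)
    qed
  next
    fix \<alpha> \<beta> r x assume \<alpha>: "\<alpha> \<in> \<Omega>" and \<beta>: "\<beta> \<in> \<Omega>" and r: "r \<in> carrier R" and "x \<in> carrier F"
    then obtain a where a: "a \<in> carrier MR" "x = \<pi> a" by (auto simp: carrier_F)
    define z where "z = P \<alpha> r \<odot>\<^bsub>MR\<^esub> MRop \<beta> a"
    define z1 where "z1 = MRop \<alpha> (r \<odot>\<^bsub>MR\<^esub> MRop \<beta> a)"
    define z2 where "z2 = MRop \<beta> (P \<alpha> r \<odot>\<^bsub>MR\<^esub> a)"
    define z3 where "z3 = (lam \<beta> \<odot>\<^bsub>R\<^esub> \<one>\<^bsub>R\<^esub>) \<odot>\<^bsub>MR\<^esub> MRop \<alpha> (r \<odot>\<^bsub>MR\<^esub> a)"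
    define z4 where "z4 = (lam \<alpha> \<odot>\<^bsub>R\<^esub> \<one>\<^bsub>R\<^esub>) \<odot>\<^bsub>MR\<^esub> MRop \<beta> (r \<odot>\<^bsub>MR\<^esub> a)"
    have zs: "z \<in> carrier MR" "z1 \<in> carrier MR" "z2 \<in> carrier MR" "z3 \<in> carrier MR" "z4 \<in> carrier MR"
      using \<alpha> \<beta> r a by (auto simp: z_def z1_def z2_def z3_def z4_def intro!: MR.lsmult_closed
          MR_op_closed P_closed weight_one_closed)
    have "z \<ominus>\<^bsub>MR\<^esub> z1 \<ominus>\<^bsub>MR\<^esub> z2 \<ominus>\<^bsub>MR\<^esub> z3 \<ominus>\<^bsub>MR\<^esub> z4 \<in> RB_relations K R \<Omega> lam P X"
      unfolding RB_relations_def Let_def z_def z1_def z2_def z3_def z4_def restrict_scalars_simps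
      using \<alpha> \<beta> r a by blast
    then have "\<pi> (z \<ominus>\<^bsub>MR\<^esub> z1 \<ominus>\<^bsub>MR\<^esub> z2 \<ominus>\<^bsub>MR\<^esub> z3 \<ominus>\<^bsub>MR\<^esub> z4) = \<zero>\<^bsub>F\<^esub>"
      using I_relations coset_eq_zero[OF MR_left_module I_submodule]
      by (auto simp: free_RB_module_def)
    then have "\<pi> z \<ominus>\<^bsub>F\<^esub> \<pi> z1 \<ominus>\<^bsub>F\<^esub> \<pi> z2 \<ominus>\<^bsub>F\<^esub> \<pi> z3 \<ominus>\<^bsub>F\<^esub> \<pi> z4 = \<zero>\<^bsub>F\<^esub>"
      using zs by (simp add: linear_maps_minus[OF MR_left_module F_left_module \<pi>_linear] MR.M.minus_closed)
    then have "\<pi> z = \<pi> z1 \<oplus>\<^bsub>F\<^esub> \<pi> z2 \<oplus>\<^bsub>F\<^esub> \<pi> z3 \<oplus>\<^bsub>F\<^esub> \<pi> z4"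
      using zs by (simp add: F.M.minus_eq_zero_iff4 \<pi>_closed)
    then show "P \<alpha> r \<odot>\<^bsub>F\<^esub> free_RB_op K R \<Omega> lam P X \<beta> x =
        free_RB_op K R \<Omega> lam P X \<alpha> (r \<odot>\<^bsub>F\<^esub> free_RB_op K R \<Omega> lam P X \<beta> x)
        \<oplus>\<^bsub>F\<^esub> free_RB_op K R \<Omega> lam P X \<beta> (P \<alpha> r \<odot>\<^bsub>F\<^esub> x)
        \<oplus>\<^bsub>F\<^esub> lam \<beta> \<odot>\<^bsub>restrict_scalars R F\<^esub> free_RB_op K R \<Omega> lam P X \<alpha> (r \<odot>\<^bsub>F\<^esub> x)
        \<oplus>\<^bsub>F\<^esub> lam \<alpha> \<odot>\<^bsub>restrict_scalars R F\<^esub> free_RB_op K R \<Omega> lam P X \<beta> (r \<odot>\<^bsub>F\<^esub> x)"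
      using \<alpha> \<beta> r a(1)
      by (simp add: a(2) z_def z1_def z2_def z3_def z4_def op_\<pi> linear_maps_smult[OF \<pi>_linear, symmetric]
          MR_op_closed MR.lsmult_closed P_closed weight_one_closed)
  qed
qed

lemma incl_closed: "free_RB_incl K R \<Omega> lam P X \<in> X \<rightarrow> carrier F"
  using linear_maps_closed[OF \<pi>_linear MR_incl_closed] by (auto simp: free_RB_incl_def)

text \<open>
  The kernel of the evaluation is one of the submodules whose intersection is the ideal; for the
  relations this is the Rota-Baxter identity of the target.
\<close>

lemma hom_exists:
  assumes M: "RB_module K R \<Omega> lam P (M :: ('r, 'm) module) m" and \<phi>: "\<phi> \<in> X \<rightarrow> carrier M"
  obtains h where "h \<in> RB_module_homs R \<Omega> F (free_RB_op K R \<Omega> lam P X) M m"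
    and "h \<in> extensional (carrier F)" and "\<And>x. x \<in> X \<Longrightarrow> h (free_RB_incl K R \<Omega> lam P X x) = \<phi> x"
proof -
  interpret M: RB_module K R \<Omega> lam P M m by (rule M)
  interpret ev: RB_evaluation K R \<Omega> X M m \<phi>
    by unfold_locales (use \<phi> M.m_linear in auto)
  interpret F: left_module R F by (rule F_left_module)
  have Mlm: "left_module R M" by (rule M.left_module_axioms)
  obtain E where E: "E \<in> linear_maps R MR M"
    and E_op: "\<And>\<omega> a. \<lbrakk>\<omega> \<in> \<Omega>; a \<in> carrier MR\<rbrakk> \<Longrightarrow> E (MRop \<omega> a) = m \<omega> (E a)"
    and E_incl: "\<And>x. x \<in> X \<Longrightarrow> E (MR_incl K R \<Omega> X x) = \<phi> x"
    using ev.evaluation_exists by blast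
  have m_zero: "m \<omega> \<zero>\<^bsub>M\<^esub> = \<zero>\<^bsub>M\<^esub>" if "\<omega> \<in> \<Omega>" for \<omega>
    using linear_maps_zero[OF ev.MK_left_module ev.MK_left_module M.m_linear[OF that]] by simp
  have E_closed: "E a \<in> carrier M" if "a \<in> carrier MR" for a
    using linear_maps_closed[OF E that] .
  have "I \<subseteq> {a \<in> carrier MR. E a = \<zero>\<^bsub>M\<^esub>}"
  proof (rule I_least[OF submodule_kernel[OF MR_left_module Mlm E]])
    show "MRop \<omega> a \<in> {a \<in> carrier MR. E a = \<zero>\<^bsub>M\<^esub>}"
      if "\<omega> \<in> \<Omega>" "a \<in> {a \<in> carrier MR. E a = \<zero>\<^bsub>M\<^esub>}" for \<omega> a
      using that by (simp add: E_op m_zero MR_op_closed)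
    show "RB_relations K R \<Omega> lam P X \<subseteq> {a \<in> carrier MR. E a = \<zero>\<^bsub>M\<^esub>}"
    proof
      fix y assume y: "y \<in> RB_relations K R \<Omega> lam P X"
      then obtain \<alpha> \<beta> r a where \<alpha>: "\<alpha> \<in> \<Omega>" and \<beta>: "\<beta> \<in> \<Omega>" and r: "r \<in> carrier R"
        and a: "a \<in> carrier MR"
        and y_eq: "y = P \<alpha> r \<odot>\<^bsub>MR\<^esub> MRop \<beta> a \<ominus>\<^bsub>MR\<^esub> MRop \<alpha> (r \<odot>\<^bsub>MR\<^esub> MRop \<beta> a)
          \<ominus>\<^bsub>MR\<^esub> MRop \<beta> (P \<alpha> r \<odot>\<^bsub>MR\<^esub> a) \<ominus>\<^bsub>MR\<^esub> lam \<beta> \<odot>\<^bsub>restrict_scalars R MR\<^esub> MRop \<alpha> (r \<odot>\<^bsub>MR\<^esub> a)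
          \<ominus>\<^bsub>MR\<^esub> lam \<alpha> \<odot>\<^bsub>restrict_scalars R MR\<^esub> MRop \<beta> (r \<odot>\<^bsub>MR\<^esub> a)"
        unfolding RB_relations_def Let_def by blast
      note closed = MR_op_closed MR.lsmult_closed P_closed weight_one_closed MR.M.minus_closed
      note Mclosed = ev.m_closed M.lsmult_closed P_closed weight_one_closed E_closed
      have "E y = P \<alpha> r \<odot>\<^bsub>M\<^esub> m \<beta> (E a) \<ominus>\<^bsub>M\<^esub> m \<alpha> (r \<odot>\<^bsub>M\<^esub> m \<beta> (E a))
          \<ominus>\<^bsub>M\<^esub> m \<beta> (P \<alpha> r \<odot>\<^bsub>M\<^esub> E a) \<ominus>\<^bsub>M\<^esub> lam \<beta> \<odot>\<^bsub>restrict_scalars R M\<^esub> m \<alpha> (r \<odot>\<^bsub>M\<^esub> E a)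
          \<ominus>\<^bsub>M\<^esub> lam \<alpha> \<odot>\<^bsub>restrict_scalars R M\<^esub> m \<beta> (r \<odot>\<^bsub>M\<^esub> E a)"
        using \<alpha> \<beta> r a
        by (simp add: y_eq linear_maps_minus[OF MR_left_module Mlm E] linear_maps_smult[OF E] E_op closed)
      also have "\<dots> = \<zero>\<^bsub>M\<^esub>"
        using M.RB_module_identity[OF \<alpha> \<beta> r E_closed[OF a]] \<alpha> \<beta> r a
        by (subst M.M.minus_eq_zero_iff4) (simp_all add: Mclosed)
      finally show "y \<in> {a \<in> carrier MR. E a = \<zero>\<^bsub>M\<^esub>}"
        using y RB_relations_closed by auto
    qed
  qed
  then have E_I: "E a = \<zero>\<^bsub>M\<^esub>" if "a \<in> I" for a using that by blast
  obtain g where g: "g \<in> linear_maps R F M" and g_\<pi>: "\<And>a. a \<in> carrier MR \<Longrightarrow> g (\<pi> a) = E a"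
    using quotient_universal[OF MR_left_module I_submodule Mlm E E_I]
    unfolding free_RB_module_def by metis
  define h where "h = restrict g (carrier F)"
  have h_\<pi>: "h (\<pi> a) = E a" if "a \<in> carrier MR" for a
    using that linear_maps_closed[OF \<pi>_linear that] by (simp add: h_def g_\<pi>)
  have "h \<in> linear_maps R F M"
    using linear_maps_cong[OF F_left_module, of h g] g unfolding h_def
    by (meson restrict_apply')
  moreover have "h (free_RB_op K R \<Omega> lam P X \<omega> x) = m \<omega> (h x)" if "\<omega> \<in> \<Omega>" "x \<in> carrier F" for \<omega> x
    using that by (auto simp: carrier_F op_\<pi> h_\<pi> MR_op_closed E_op)
  ultimately have "h \<in> RB_module_homs R \<Omega> F (free_RB_op K R \<Omega> lam P X) M m"
    by (simp add: RB_module_homs_def)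
  moreover have "h \<in> extensional (carrier F)" by (simp add: h_def)
  moreover have "h (free_RB_incl K R \<Omega> lam P X x) = \<phi> x" if "x \<in> X" for x
    using that by (simp add: free_RB_incl_def h_\<pi> MR_incl_closed E_incl)
  ultimately show thesis by (rule that)
qed

text \<open>
  Two homomorphisms agree on a submodule of \<open>M\<^sub>R(X)\<close> that is stable under the operators and contains
  the generators.
\<close>

lemma hom_unique:
  assumes M: "RB_module K R \<Omega> lam P (M :: ('r, 'm) module) m"
    and h: "h \<in> RB_module_homs R \<Omega> F (free_RB_op K R \<Omega> lam P X) M m"
    and h': "h' \<in> RB_module_homs R \<Omega> F (free_RB_op K R \<Omega> lam P X) M m"
    and ext: "h \<in> extensional (carrier F)" "h' \<in> extensional (carrier F)"
    and agree: "\<And>x. x \<in> X \<Longrightarrow> h (free_RB_incl K R \<Omega> lam P X x) = h' (free_RB_incl K R \<Omega> lam P X x)"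
  shows "h = h'"
proof -
  have Mlm: "left_module R M" using M by (rule RB_module.axioms(2))
  have lin: "h \<in> linear_maps R F M" "h' \<in> linear_maps R F M"
    and op: "\<And>\<omega> x. \<lbrakk>\<omega> \<in> \<Omega>; x \<in> carrier F\<rbrakk> \<Longrightarrow> h (free_RB_op K R \<Omega> lam P X \<omega> x) = m \<omega> (h x)"
      "\<And>\<omega> x. \<lbrakk>\<omega> \<in> \<Omega>; x \<in> carrier F\<rbrakk> \<Longrightarrow> h' (free_RB_op K R \<Omega> lam P X \<omega> x) = m \<omega> (h' x)"
    using h h' by (auto simp: RB_module_homs_def)
  have "{a \<in> carrier MR. h (\<pi> a) = h' (\<pi> a)} = carrier MR"
  proof (rule MR_generated[OF submodule_equalizer[OF MR_left_module Mlm
          linear_maps_comp[OF \<pi>_linear lin(1)] linear_maps_comp[OF \<pi>_linear lin(2)]]])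
    show "MRop \<omega> a \<in> {a \<in> carrier MR. h (\<pi> a) = h' (\<pi> a)}"
      if "\<omega> \<in> \<Omega>" "a \<in> {a \<in> carrier MR. h (\<pi> a) = h' (\<pi> a)}" for \<omega> a
      using that op[OF that(1) linear_maps_closed[OF \<pi>_linear]]
      by (simp add: op_\<pi>[symmetric]) (simp add: MR_op_closed)
    show "MR_incl K R \<Omega> X x \<in> {a \<in> carrier MR. h (\<pi> a) = h' (\<pi> a)}" if "x \<in> X" for x
      using agree[OF that] MR_incl_closed[OF that] by (simp add: free_RB_incl_def)
  qed
  then have "h x = h' x" if "x \<in> carrier F" for x using that by (auto simp: carrier_F)
  then show ?thesis using ext by (rule extensionalityI[rotated 2])
qed

lemma free_RB_module_is_free:
  "is_free_RB_module TYPE('m) K R \<Omega> lam P X F (free_RB_op K R \<Omega> lam P X) (free_RB_incl K R \<Omega> lam P X)"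
  unfolding is_free_RB_module_def
proof (intro conjI allI impI F_RB_module incl_closed; elim conjE)
  fix M :: "('r, 'm) module" and m \<phi>
  assume M: "RB_module K R \<Omega> lam P M m" and \<phi>: "\<phi> \<in> X \<rightarrow> carrier M"
  obtain h where h: "h \<in> RB_module_homs R \<Omega> F (free_RB_op K R \<Omega> lam P X) M m"
    "h \<in> extensional (carrier F)" "\<And>x. x \<in> X \<Longrightarrow> h (free_RB_incl K R \<Omega> lam P X x) = \<phi> x"
    using hom_exists[OF M \<phi>] by blast
  show "\<exists>!h. h \<in> RB_module_homs R \<Omega> F (free_RB_op K R \<Omega> lam P X) M m \<inter> extensional (carrier F) \<and>
    (\<forall>x\<in>X. h (free_RB_incl K R \<Omega> lam P X x) = \<phi> x)"
    by (rule ex1I[of _ h]) (use h in \<open>auto intro!: hom_unique[OF M]\<close>)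
qed

end

theorem theorem2p14:
  fixes K :: "('k, 'p) ring_scheme"
    and R :: "('k, 'r, 'q) module_scheme"
    and \<Omega> :: "'w set"
    and lam :: "'w \<Rightarrow> 'k"
    and P :: "'w \<Rightarrow> 'r \<Rightarrow> 'r"
    and X :: "'x set"
  assumes "\<Omega> \<noteq> {}"
    and "multiple_RB_algebra K R \<Omega> lam P"
  shows "is_free_RB_module TYPE('m) K R \<Omega> lam P X
    (free_RB_module K R \<Omega> lam P X) (free_RB_op K R \<Omega> lam P X) (free_RB_incl K R \<Omega> lam P X)"
  using RB_free_construction.free_RB_module_is_free[OF RB_free_construction.intro[OF assms(2)]] .

end
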